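(* Let $1<p<\infty$, let $n\ge 2$ be an integer, and let $a=(a_1,\dots,a_n)\in(0,\infty)^n$. Define the weighted $\ell_p$-ball $$ \mathbb B_p^n(a)=\Bigl\{x\in\mathbb R^n:\ \sum_{r=1}^n|a_rx_r|^p\le 1\Bigr\}. $$ Then, for every $j\in\{0,\dots,n-1\}$, $$ V_j(\mathbb B_p^n(a))=\frac{p(p-1)^{n-1-j}}{2\pi^{\frac{n-j}{2}}\Gamma(1+\frac jp)}\sum_{i=1}^n\ \sum_{\substack{I\subseteq\{1,\dots,n\}\setminus\{i\}\\ |I|=n-1-j}}\int_0^\infty\theta^{\frac{n-j}{2}-1}\,a_i\mathcal K_p(a_i^2\theta)\prod_{r\in I}a_r\mathcal J_p(a_r^2\theta)\prod_{r\notin I\cup\{i\}}a_r^{-1}\mathcal I_p(a_r^2\theta)\,d\theta . $$ (In the last product $r$ ranges over $\{1,\dots,n\}\setminus(I\cup\{i\})$.)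
   Context: For a convex body $K\subset\mathbb R^n$, the intrinsic volumes $V_0(K),\dots,V_n(K)$ are defined by the Steiner formula $\mathrm{Vol}_n(K+t\mathbb B_2^n)=\sum_{j=0}^n\kappa_{n-j}V_j(K)t^{n-j}$, $t\ge 0$, where $\mathbb B_2^n$ is the Euclidean unit ball and $\kappa_m=\mathrm{Vol}_m(\mathbb B_2^m)=\pi^{m/2}/\Gamma(1+\frac m2)$. For $\theta\ge 0$: $\mathcal I_p(\theta)=\int_{\mathbb R}e^{-|x|^p-\theta|x|^{2p-2}}dx$, $\mathcal J_p(\theta)=\int_{\mathbb R}|x|^{p-2}e^{-|x|^p-\theta|x|^{2p-2}}dx$, $\mathcal K_p(\theta)=\int_{\mathbb R}|x|^{2p-2}e^{-|x|^p-\theta|x|^{2p-2}}dx$. Empty products equal $1$. *)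

theory Defs
  imports "HOL-Analysis.Analysis"
begin

text \<open>The Steiner formula for a set \<open>K\<close>: the numbers \<open>V 0, \<dots>, V n\<close>, with \<open>n = DIM('a)\<close>, are the
  normalised coefficients of the volume of the parallel body \<open>K + t B\<close>, where \<open>B\<close> is the closed
  Euclidean unit ball. The values \<open>V j\<close> with \<open>j > n\<close> are irrelevant.\<close>

definition steiner_formula :: "'a::euclidean_space set \<Rightarrow> (nat \<Rightarrow> real) \<Rightarrow> bool" where
  "steiner_formula K V \<longleftrightarrow>
     (\<forall>t\<ge>0. measure lborel {x + t *\<^sub>R y |x y. x \<in> K \<and> y \<in> cball 0 1} =
        (\<Sum>j\<le>DIM('a). unit_ball_vol (real (DIM('a) - j)) * V j * t ^ (DIM('a) - j)))"

text \<open>The value is unspecified unless \<open>K\<close> satisfies a Steiner formula, as every convex body does,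
  and \<open>j \<le> DIM('a)\<close>; under these conditions it is determined, as the two lemmas below show.\<close>

definition intrinsic_volume :: "nat \<Rightarrow> 'a::euclidean_space set \<Rightarrow> real" where
  "intrinsic_volume j K = (THE v. \<exists>V. steiner_formula K V \<and> V j = v)"

lemma steiner_formula_unique:
  fixes K :: "'a::euclidean_space set"
  assumes V: "steiner_formula K V" and W: "steiner_formula K W" and j: "j \<le> DIM('a)"
  shows "V j = W j"
proof -
  define n where "n = DIM('a)"
  define c where "c i = unit_ball_vol (real i) * (V (n - i) - W (n - i))" for i
  have root: "(\<Sum>i\<le>n. c i * t ^ i) = 0" if "t \<ge> 0" for t :: real
  proof -
    have "(\<Sum>i\<le>n. c i * t ^ i) = (\<Sum>i\<le>n. c (n - i) * t ^ (n - i))"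
      by (rule sum.reindex_bij_witness[of _ "\<lambda>i. n - i" "\<lambda>i. n - i"]) auto
    also have "\<dots> = (\<Sum>i\<le>n. unit_ball_vol (real (n - i)) * V i * t ^ (n - i))
                  - (\<Sum>i\<le>n. unit_ball_vol (real (n - i)) * W i * t ^ (n - i))"
      unfolding sum_subtractf[symmetric]
      by (intro sum.cong refl) (simp add: c_def left_diff_distrib right_diff_distrib del: of_nat_diff)
    also have "\<dots> = 0"
      using V W that unfolding steiner_formula_def n_def by simp
    finally show ?thesis .
  qed
  have "infinite {t. (\<Sum>i\<le>n. c i * t ^ i) = 0}"
  proof
    assume "finite {t. (\<Sum>i\<le>n. c i * t ^ i) = 0}"
    then have "finite {0::real..}" by (rule finite_subset[rotated]) (use root in auto)
    then show False using infinite_Ici by blast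
  qed
  then have "c (n - j) = 0"
    using polyfun_roots_finite[of c "n - j" n] by auto
  moreover have "unit_ball_vol (real (n - j)) > 0" by simp
  ultimately show ?thesis using j unfolding c_def n_def by (simp del: of_nat_diff)
qed

lemma intrinsic_volume_eqI:
  fixes K :: "'a::euclidean_space set"
  assumes "steiner_formula K V" and "j \<le> DIM('a)"
  shows "intrinsic_volume j K = V j"
  unfolding intrinsic_volume_def
  using assms steiner_formula_unique by (intro the_equality) blast+

definition weighted_lp_ball :: "real \<Rightarrow> real ^ 'n \<Rightarrow> (real ^ 'n) set" where
  "weighted_lp_ball p a = {x. (\<Sum>r\<in>UNIV. \<bar>a $ r * x $ r\<bar> powr p) \<le> 1}"

definition I_fun :: "real \<Rightarrow> real \<Rightarrow> real" where
  "I_fun p \<theta> = (LINT x|lborel. exp (- (\<bar>x\<bar> powr p) - \<theta> * \<bar>x\<bar> powr (2 * p - 2)))"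

definition J_fun :: "real \<Rightarrow> real \<Rightarrow> real" where
  "J_fun p \<theta> = (LINT x|lborel. \<bar>x\<bar> powr (p - 2) * exp (- (\<bar>x\<bar> powr p) - \<theta> * \<bar>x\<bar> powr (2 * p - 2)))"

definition K_fun :: "real \<Rightarrow> real \<Rightarrow> real" where
  "K_fun p \<theta> = (LINT x|lborel. \<bar>x\<bar> powr (2 * p - 2) * exp (- (\<bar>x\<bar> powr p) - \<theta> * \<bar>x\<bar> powr (2 * p - 2)))"

end

theory Submission
  imports Defs
begin

text \<open>
  With \<open>c r = a r powr p\<close>, the body is \<open>K = {F \<le> 1}\<close> for \<open>F x = (\<Sum>r. c r * \<bar>x r\<bar> powr p)\<close>, and
  \<open>g = \<nabla>F / p\<close> acts on each coordinate separately, with derivatives \<open>d r\<close>. Surface measures are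
  avoided by letting the level \<open>u\<close> vary: the point of \<open>{F \<le> u}\<close> nearest to \<open>y\<close> is the \<open>x\<close> with
  \<open>y = x + s g(x)\<close> and \<open>F x = u\<close>. For fixed \<open>y\<close> one substitutes \<open>u = F x\<close>, a decreasing function
  of \<open>s\<close> with derivative \<open>- p (\<Sum>i. g i\<^sup>2 / (1 + s d i))\<close>; for fixed \<open>s\<close> one substitutes
  \<open>y = x + s g(x)\<close> coordinatewise, with Jacobian \<open>\<Prod>r. 1 + s d r\<close>. So only one-dimensional
  substitutions and Tonelli's theorem are needed to turn integrals over \<open>(u, y)\<close> into integrals
  over \<open>(x, s)\<close> of the polynomial \<open>p (\<Sum>i. g i\<^sup>2 (\<Prod>r\<noteq>i. 1 + s d r))\<close> in \<open>s\<close>.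

  Integrating \<open>exp (- u)\<close> over the pairs at distance at most \<open>t u powr (1 / p)\<close> shows, by homogeneity,
  that \<open>Vol (K + t B) - Vol K\<close> is a polynomial in \<open>t\<close>. Taking distance at most \<open>t\<close> instead
  multiplies the coefficient of \<open>t ^ m\<close> by an explicit quotient of Gamma values, and gives it as
  an integral against \<open>exp (- F) / \<bar>g\<bar> ^ m\<close>. Writing \<open>1 / \<bar>g\<bar> ^ m\<close> as an integral of
  \<open>\<theta> powr (m / 2 - 1) * exp (- \<theta> \<bar>g\<bar>\<^sup>2)\<close> makes the integrand a product over the coordinates.
\<close>

section \<open>Change of variables for nonnegative integrals\<close>

lemma nn_integral_change_of_variables_indicator:
  fixes f f' :: "real \<Rightarrow> real"
  assumes S: "S \<in> sets borel" and fS: "f ` S \<in> sets borel"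
    and [measurable]: "f \<in> borel_measurable borel" "f' \<in> borel_measurable borel"
    and der: "\<And>x. x \<in> S \<Longrightarrow> (f has_real_derivative f' x) (at x within S)"
    and inj: "inj_on f S"
    and A: "A \<in> sets borel" "bounded A"
  shows "(\<integral>\<^sup>+x. ennreal \<bar>f' x\<bar> * indicator A (f x) * indicator S x \<partial>lborel) = emeasure lborel (A \<inter> f ` S)"
proof -
  have [measurable]: "A \<in> sets borel" "S \<in> sets borel" "f ` S \<in> sets borel" using A S fS by auto
  have fin: "emeasure lborel (A \<inter> f ` S) < \<infinity>"
    using emeasure_mono[of "A \<inter> f ` S" A lborel] emeasure_bounded_finite[OF A(2)] A(1)
    by (auto simp: top.not_eq_extremum)
  have int: "(\<lambda>x. indicat_real A x) absolutely_integrable_on f ` S"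
    unfolding set_integrable_def
    using fin by (intro integrable_completion[THEN iffD2])
      (auto simp: indicator_inter_arith[symmetric] Int_commute intro!: integrable_real_indicator)
  have b: "integral (f ` S) (\<lambda>x. indicat_real A x) = measure lborel (A \<inter> f ` S)"
  proof -
    have "((\<lambda>x. 1::real) has_integral measure lborel (A \<inter> f ` S)) (A \<inter> f ` S)"
      using fin by (intro has_integral_measure_lborel) auto
    then have "((\<lambda>x. if x \<in> A \<inter> f ` S then 1 else 0::real) has_integral measure lborel (A \<inter> f ` S)) (f ` S)"
      by (subst has_integral_restrict) auto
    then have "((\<lambda>x. indicat_real A x) has_integral measure lborel (A \<inter> f ` S)) (f ` S)"
      by (rule has_integral_eq[rotated]) (auto simp: indicator_def)
    then show ?thesis by (rule integral_unique)
  qed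
  have "(\<lambda>x. \<bar>f' x\<bar> * indicat_real A (f x)) absolutely_integrable_on S \<and>
        integral S (\<lambda>x. \<bar>f' x\<bar> * indicat_real A (f x)) = measure lborel (A \<inter> f ` S)"
    using has_absolute_integral_change_of_variables_1'[OF _ der inj, of "indicat_real A"] int b S by auto
  then have "((\<lambda>x. \<bar>f' x\<bar> * indicat_real A (f x)) has_integral measure lborel (A \<inter> f ` S)) S"
    using has_integral_integral set_lebesgue_integral_eq_integral(1) by metis
  then have "((\<lambda>x. if x \<in> S then \<bar>f' x\<bar> * indicat_real A (f x) else 0) has_integral measure lborel (A \<inter> f ` S)) UNIV"
    by (simp add: has_integral_restrict_UNIV)
  moreover have "(\<lambda>x. if x \<in> S then \<bar>f' x\<bar> * indicat_real A (f x) else 0) = (\<lambda>x. \<bar>f' x\<bar> * indicator A (f x) * indicator S x)"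
    by (auto simp: indicator_def)
  ultimately have "(\<integral>\<^sup>+x. ennreal (\<bar>f' x\<bar> * indicator A (f x) * indicator S x) \<partial>lborel) = measure lborel (A \<inter> f ` S)"
    by (intro nn_integral_has_integral_lborel) auto
  also have "\<dots> = emeasure lborel (A \<inter> f ` S)"
    using fin by (simp add: emeasure_eq_ennreal_measure top.not_eq_extremum)
  finally show ?thesis
    by (simp add: ennreal_mult' ennreal_indicator)
qed

lemma nn_integral_change_of_variables_real:
  fixes f f' :: "real \<Rightarrow> real" and h :: "real \<Rightarrow> ennreal"
  assumes S: "S \<in> sets borel" and fS: "f ` S \<in> sets borel"
    and f [measurable]: "f \<in> borel_measurable borel" "f' \<in> borel_measurable borel"
    and der: "\<And>x. x \<in> S \<Longrightarrow> (f has_real_derivative f' x) (at x within S)"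
    and inj: "inj_on f S"
    and h [measurable]: "h \<in> borel_measurable borel"
  shows "(\<integral>\<^sup>+x. ennreal \<bar>f' x\<bar> * h (f x) * indicator S x \<partial>lborel) = (\<integral>\<^sup>+y. h y * indicator (f ` S) y \<partial>lborel)"
proof -
  have [measurable]: "S \<in> sets borel" "f ` S \<in> sets borel" using S fS by auto
  define M where "M = distr (density lborel (\<lambda>x. ennreal \<bar>f' x\<bar> * indicator S x)) borel f"
  define N where "N = density lborel (indicator (f ` S) :: real \<Rightarrow> ennreal)"
  have eq: "emeasure M A = emeasure N A" if A [measurable]: "A \<in> sets borel" for A
  proof -
    \<comment> \<open>Cutting with balls gives bounded sets increasing to \<open>A\<close>;
      continuity from below then avoids any finiteness assumption on the two measures.\<close>
    define B where "B k = A \<inter> cball 0 (real k)" for k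
    have B: "B k \<in> sets borel" for k unfolding B_def by simp
    note [measurable] = B
    have "incseq B" unfolding B_def incseq_def by (auto intro: order_trans)
    have UB: "(\<Union>k. B k) = A" unfolding B_def by (auto simp: real_arch_simple)
    have "emeasure M (B k) = emeasure N (B k)" for k
    proof -
      have "emeasure M (B k) = (\<integral>\<^sup>+x. ennreal \<bar>f' x\<bar> * indicator (B k) (f x) * indicator S x \<partial>lborel)"
        unfolding M_def
        by (subst emeasure_distr, simp, simp, subst emeasure_density)
          (auto simp: indicator_def intro!: nn_integral_cong measurable_sets_borel[OF f(1)])
      also have "\<dots> = emeasure lborel (B k \<inter> f ` S)"
        using bounded_Int[of A "cball 0 (real k)"]
        by (intro nn_integral_change_of_variables_indicator assms) (auto simp: B_def)
      also have "\<dots> = (\<integral>\<^sup>+x. indicator (B k \<inter> f ` S) x \<partial>lborel)"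
        by (rule nn_integral_indicator[symmetric]) simp
      also have "\<dots> = (\<integral>\<^sup>+x. indicator (f ` S) x * indicator (B k) x \<partial>lborel)"
        by (intro nn_integral_cong) (simp split: split_indicator)
      also have "\<dots> = emeasure N (B k)"
        unfolding N_def by (rule emeasure_density[symmetric]) simp_all
      finally show ?thesis .
    qed
    moreover have "(\<lambda>k. emeasure M (B k)) \<longlonglongrightarrow> emeasure M A"
      unfolding UB[symmetric] using B \<open>incseq B\<close> by (intro Lim_emeasure_incseq) (auto simp: M_def)
    moreover have "(\<lambda>k. emeasure N (B k)) \<longlonglongrightarrow> emeasure N A"
      unfolding UB[symmetric] using B \<open>incseq B\<close> by (intro Lim_emeasure_incseq) (auto simp: N_def)
    ultimately show ?thesis using LIMSEQ_unique by auto
  qed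
  have "M = N" by (rule measure_eqI) (auto simp: M_def N_def eq[unfolded M_def N_def])
  then have "(\<integral>\<^sup>+x. h x \<partial>M) = (\<integral>\<^sup>+x. h x \<partial>N)" by simp
  then show ?thesis
    unfolding M_def N_def by (simp add: nn_integral_distr nn_integral_density mult_ac)
qed

section \<open>Lebesgue measure on real vectors and coordinatewise maps\<close>

lemma borel_measurable_vec_nth [measurable]: "(\<lambda>x::real^'n. x $ r) \<in> borel_measurable borel"
  by (intro borel_measurable_continuous_onI continuous_intros)

lemma borel_measurable_vec_lambda [measurable (raw)]:
  fixes f :: "'n::finite \<Rightarrow> 'a \<Rightarrow> real"
  assumes [measurable]: "\<And>r. f r \<in> borel_measurable M"
  shows "(\<lambda>x. \<chi> r. f r x) \<in> borel_measurable M"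
  by (subst borel_measurable_euclidean_space) (auto simp: Basis_vec_def inner_axis)

lemma nn_integral_lborel_vec_prod:
  fixes f :: "'n::finite \<Rightarrow> real \<Rightarrow> ennreal"
  assumes [measurable]: "\<And>r. f r \<in> borel_measurable borel"
  shows "(\<integral>\<^sup>+(x::real^'n). (\<Prod>r\<in>UNIV. f r (x $ r)) \<partial>lborel) = (\<Prod>r\<in>UNIV. \<integral>\<^sup>+x. f r x \<partial>lborel)"
proof -
  \<comment> \<open>Reindexes the factors by basis vectors instead of coordinates; the description
    is unique because distinct coordinates have distinct unit vectors.\<close>
  define F where "F b = f (THE r. b = axis r 1)" for b :: "real^'n"
  have F: "F (axis r 1) = f r" for r
    unfolding F_def by (auto simp: axis_eq_axis)
  have inj: "inj (\<lambda>r. axis r 1 :: real^'n)" by (auto simp: inj_def axis_eq_axis)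
  have B: "Basis = range (\<lambda>r. axis r 1 :: real^'n)" by (auto simp: Basis_vec_def)
  have [measurable]: "F b \<in> borel_measurable borel" for b unfolding F_def by simp
  have "(\<integral>\<^sup>+(x::real^'n). (\<Prod>b\<in>Basis. F b (x \<bullet> b)) \<partial>lborel) = (\<Prod>b\<in>Basis. \<integral>\<^sup>+x. F b x \<partial>lborel)"
    by (rule nn_integral_lborel_prod) auto
  then show ?thesis
    unfolding B by (simp add: prod.reindex[OF inj] F inner_axis)
qed

text \<open>Lebesgue measure is determined by its values on boxes, and for a coordinatewise map
  these are products of one-dimensional integrals. This replaces a Jacobian theorem in n dimensions,
  which would ask for differentiability on the coordinate hyperplanes.\<close>

lemma lborel_distr_coordinatewise:
  fixes \<phi> w :: "'n::finite \<Rightarrow> real \<Rightarrow> real"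
  assumes [measurable]: "\<And>r. \<phi> r \<in> borel_measurable borel" "\<And>r. w r \<in> borel_measurable borel"
    and w: "\<And>r x. 0 \<le> w r x"
    and eq: "\<And>r l u. l \<le> u \<Longrightarrow> (\<integral>\<^sup>+x. ennreal (w r x) * indicator {l<..<u} (\<phi> r x) \<partial>lborel) = ennreal (u - l)"
  shows "distr (density lborel (\<lambda>x::real^'n. \<Prod>r\<in>UNIV. ennreal (w r (x $ r)))) borel (\<lambda>x. \<chi> r. \<phi> r (x $ r)) = lborel"
proof (rule lborel_eqI[symmetric])
  have m [measurable]: "(\<lambda>x::real^'n. \<chi> r. \<phi> r (x $ r)) \<in> borel_measurable borel"
    by simp
  fix l u :: "real^'n" assume le: "\<And>b. b \<in> Basis \<Longrightarrow> l \<bullet> b \<le> u \<bullet> b"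
  have le': "l $ r \<le> u $ r" for r
    using le[of "axis r 1"] by (auto simp: Basis_vec_def inner_axis)
  have "emeasure (distr (density lborel (\<lambda>x::real^'n. \<Prod>r\<in>UNIV. ennreal (w r (x $ r)))) borel (\<lambda>x. \<chi> r. \<phi> r (x $ r))) (box l u)
     = (\<integral>\<^sup>+x. (\<Prod>r\<in>UNIV. ennreal (w r (x $ r))) * indicator (box l u) (\<chi> r. \<phi> r (x $ r)) \<partial>lborel)"
    by (subst emeasure_distr, simp, simp, subst emeasure_density)
       (auto simp: indicator_def intro!: nn_integral_cong measurable_sets_borel[OF m])
  also have "\<dots> = (\<integral>\<^sup>+x. (\<Prod>r\<in>UNIV. ennreal (w r (x $ r)) * indicator {l $ r <..< u $ r} (\<phi> r (x $ r))) \<partial>lborel)"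
  proof (intro nn_integral_cong)
    fix x :: "real^'n"
    have "(indicator (box l u) (\<chi> r. \<phi> r (x $ r)) :: ennreal) = (\<Prod>r\<in>UNIV. indicator {l $ r <..< u $ r} (\<phi> r (x $ r)))"
      by (auto simp: indicator_def mem_box_cart)
    then show "(\<Prod>r\<in>UNIV. ennreal (w r (x $ r))) * indicator (box l u) (\<chi> r. \<phi> r (x $ r)) =
      (\<Prod>r\<in>UNIV. ennreal (w r (x $ r)) * indicator {l $ r <..< u $ r} (\<phi> r (x $ r)))"
      by (simp add: prod.distrib)
  qed
  also have "\<dots> = (\<Prod>r\<in>UNIV. ennreal (u $ r - l $ r))"
    by (subst nn_integral_lborel_vec_prod) (simp_all add: eq le')
  also have "\<dots> = ennreal (\<Prod>r\<in>UNIV. (u $ r - l $ r))"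
    by (rule prod_ennreal) (simp add: le')
  also have "(\<Prod>r\<in>UNIV. (u $ r - l $ r)) = (\<Prod>b\<in>Basis. (u - l) \<bullet> b)"
  proof -
    have inj: "inj (\<lambda>r. axis r 1 :: real^'n)" by (auto simp: inj_def axis_eq_axis)
    have B: "Basis = range (\<lambda>r. axis r 1 :: real^'n)" by (auto simp: Basis_vec_def)
    show ?thesis unfolding B by (simp add: prod.reindex[OF inj] inner_axis)
  qed
  finally show "emeasure (distr (density lborel (\<lambda>x::real^'n. \<Prod>r\<in>UNIV. ennreal (w r (x $ r)))) borel (\<lambda>x. \<chi> r. \<phi> r (x $ r))) (box l u) = (\<Prod>b\<in>Basis. (u - l) \<bullet> b)" .
qed simp

section \<open>The normal map in one dimension\<close>

text \<open>Up to the factor \<open>p\<close>, these are the first two derivatives of \<open>c * \<bar>x\<bar> powr p\<close>. For \<open>p < 2\<close> the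
  second one is infinite at \<open>x = 0\<close>, where \<open>power_hess\<close> has the value \<open>0\<close>.\<close>

definition power_grad :: "real \<Rightarrow> real \<Rightarrow> real \<Rightarrow> real" where
  "power_grad p c x = c * sgn x * \<bar>x\<bar> powr (p - 1)"

definition power_hess :: "real \<Rightarrow> real \<Rightarrow> real \<Rightarrow> real" where
  "power_hess p c x = c * (p - 1) * \<bar>x\<bar> powr (p - 2)"

text \<open>The truncation \<open>max 0 s\<close> makes the resolvent Borel measurable for all real \<open>s\<close>.\<close>

definition resolvent :: "real \<Rightarrow> real \<Rightarrow> real \<Rightarrow> real \<Rightarrow> real" where
  "resolvent p c s = inv (\<lambda>x. x + max 0 s * power_grad p c x)"

lemma borel_measurable_power_grad [measurable]: "power_grad p c \<in> borel_measurable borel"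
  unfolding power_grad_def sgn_real_def by measurable

lemma borel_measurable_power_hess [measurable]: "power_hess p c \<in> borel_measurable borel"
  unfolding power_hess_def by measurable

lemma power_grad_0 [simp]: "power_grad p c 0 = 0"
  by (simp add: power_grad_def)

text \<open>Euler's identity for the homogeneous function \<open>c * \<bar>x\<bar> powr p\<close>,
  divided by \<open>p\<close>.\<close>

lemma power_grad_mult_self: "1 < p \<Longrightarrow> power_grad p c x * x = c * \<bar>x\<bar> powr p"
proof (cases "x = 0")
  case False
  have "\<bar>x\<bar> powr p = \<bar>x\<bar> * \<bar>x\<bar> powr (p - 1)"
    using False by (subst powr_mult_base) auto
  then show ?thesis
    using False by (simp add: power_grad_def sgn_if)
qed simp

lemma DERIV_power_grad:
  assumes "1 < p" "x \<noteq> 0"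
  shows "(power_grad p c has_real_derivative power_hess p c x) (at x)"
proof (cases "x > 0")
  case True
  have "((\<lambda>x. c * x powr (p - 1)) has_real_derivative power_hess p c x) (at x)"
    using True assms by (auto intro!: derivative_eq_intros simp: power_hess_def)
  then show ?thesis
    by (rule has_field_derivative_transform_within_open[where S = "{0<..}"]) (use True in \<open>auto simp: power_grad_def\<close>)
next
  case False
  then have x: "x < 0" using assms by simp
  have "((\<lambda>x. - c * (-x) powr (p - 1)) has_real_derivative power_hess p c x) (at x)"
    using x assms by (auto intro!: derivative_eq_intros simp: power_hess_def)
  then show ?thesis
    by (rule has_field_derivative_transform_within_open[where S = "{..<0}"]) (use x in \<open>auto simp: power_grad_def\<close>)
qed

context
  fixes p c :: real
  assumes p: "1 < p" and c: "0 < c"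
begin

lemma power_hess_nonneg: "0 \<le> power_hess p c x"
  using p c by (simp add: power_hess_def)

text \<open>Splitting into positive and negative parts removes the sign function, so continuity and
  monotonicity across 0 reduce to those of \<open>powr\<close> on nonnegative reals.\<close>

lemma power_grad_eq: "power_grad p c x = c * ((max x 0) powr (p - 1) - (max (-x) 0) powr (p - 1))"
  using p by (auto simp: power_grad_def max_def sgn_if abs_if)

lemma continuous_on_power_grad: "continuous_on A (power_grad p c)"
  unfolding power_grad_eq [abs_def] using p
  by (intro continuous_intros continuous_on_powr') auto

lemma power_grad_mono: "x \<le> y \<Longrightarrow> power_grad p c x \<le> power_grad p c y"
  unfolding power_grad_eq using p c
  by (intro mult_left_mono diff_mono powr_mono2) auto

lemma power_grad_eq_0_iff: "power_grad p c x = 0 \<longleftrightarrow> x = 0"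
  using c by (simp add: power_grad_def sgn_if)

lemma abs_power_grad: "\<bar>power_grad p c x\<bar> = c * \<bar>x\<bar> powr (p - 1)"
  using c by (auto simp: power_grad_def abs_mult sgn_if)

lemma abs_power_grad_mono: "\<bar>x\<bar> \<le> \<bar>y\<bar> \<Longrightarrow> \<bar>power_grad p c x\<bar> \<le> \<bar>power_grad p c y\<bar>"
  unfolding abs_power_grad using p c by (intro mult_left_mono powr_mono2) auto

lemma power_grad_sq: "(power_grad p c x)\<^sup>2 = c\<^sup>2 * \<bar>x\<bar> powr (2 * p - 2)"
proof -
  have "(power_grad p c x)\<^sup>2 = \<bar>power_grad p c x\<bar>\<^sup>2" by simp
  also have "\<dots> = c\<^sup>2 * (\<bar>x\<bar> powr (p - 1))\<^sup>2" unfolding abs_power_grad by (simp add: power_mult_distrib)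
  also have "(\<bar>x\<bar> powr (p - 1))\<^sup>2 = \<bar>x\<bar> powr (2 * p - 2)"
    by (cases "x = 0") (simp_all add: power2_eq_square powr_add[symmetric])
  finally show ?thesis .
qed

lemma DERIV_abs_powr: "((\<lambda>x. c * \<bar>x\<bar> powr p) has_real_derivative p * power_grad p c x) (at x)"
proof (cases "x = 0")
  case False
  consider "x > 0" | "x < 0" using False by linarith
  then show ?thesis
  proof cases
    case 1
    have "((\<lambda>x. c * x powr p) has_real_derivative p * power_grad p c x) (at x)"
      using 1 p by (auto intro!: derivative_eq_intros simp: power_grad_def)
    then show ?thesis
      by (rule has_field_derivative_transform_within_open[where S = "{0<..}"]) (use 1 in \<open>auto\<close>)
  next
    case 2
    have "((\<lambda>x. c * (-x) powr p) has_real_derivative p * power_grad p c x) (at x)"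
      using 2 p by (auto intro!: derivative_eq_intros simp: power_grad_def)
    then show ?thesis
      by (rule has_field_derivative_transform_within_open[where S = "{..<0}"]) (use 2 in \<open>auto\<close>)
  qed
next
  case True
  have "isCont (power_grad p c) 0"
    using continuous_on_power_grad[of UNIV] by (simp add: continuous_on_eq_continuous_at)
  then have "((\<lambda>h. power_grad p c h) \<longlongrightarrow> 0) (at 0)" by (simp add: isCont_def)
  \<comment> \<open>By Euler's identity the difference quotient at 0 is
    \<open>power_grad p c h\<close> itself, which tends to 0 because \<open>p > 1\<close>.\<close>
  then have "((\<lambda>h. (c * \<bar>0 + h\<bar> powr p - c * \<bar>0\<bar> powr p) / h) \<longlongrightarrow> 0) (at 0)"
  proof (rule Lim_transform_eventually)
    show "\<forall>\<^sub>F h in at 0. power_grad p c h = (c * \<bar>0 + h\<bar> powr p - c * \<bar>0\<bar> powr p) / h"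
      by (simp add: eventually_at_filter nonzero_eq_divide_eq power_grad_mult_self[OF p])
  qed
  then show ?thesis using True by (simp add: DERIV_def)
qed

lemma power_tangent: "c * \<bar>z\<bar> powr p \<ge> c * \<bar>x\<bar> powr p + p * power_grad p c x * (z - x)"
proof -
  have "convex_on UNIV (\<lambda>x. c * \<bar>x\<bar> powr p)"
    using p by (intro convex_on_realI[where f' = "\<lambda>x. p * power_grad p c x"] DERIV_abs_powr mult_left_mono power_grad_mono) auto
  then have "c * \<bar>z\<bar> powr p - c * \<bar>x\<bar> powr p \<ge> (p * power_grad p c x) * (z - x)"
    by (rule convex_on_imp_above_tangent) (use DERIV_abs_powr[of x] in \<open>auto simp: has_field_derivative_at_within\<close>)
  then show ?thesis by (simp add: algebra_simps)
qed

lemma strict_mono_normal_map: "s \<ge> 0 \<Longrightarrow> strict_mono (\<lambda>x. x + s * power_grad p c x)"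
  by (intro strict_monoI add_less_le_mono mult_left_mono power_grad_mono) auto

lemma bij_normal_map:
  assumes s: "s \<ge> 0" shows "bij (\<lambda>x. x + s * power_grad p c x)"
proof (rule bijI)
  let ?f = "\<lambda>x. x + s * power_grad p c x"
  show "inj ?f" using strict_mono_normal_map[OF s] by (rule strict_mono_imp_inj_on)
  show "surj ?f"
  proof (rule surjI[of _ "\<lambda>y. SOME x. ?f x = y"], rule someI_ex)
    fix y :: real
    \<comment> \<open>The gradient has the sign of its argument, so the normal map moves
      \<open>\<bar>y\<bar>\<close> up and \<open>- \<bar>y\<bar>\<close> down; the interval between
      them brackets a preimage of \<open>y\<close>.\<close>
    have "0 \<le> power_grad p c \<bar>y\<bar>" "power_grad p c (- \<bar>y\<bar>) \<le> 0"
      using power_grad_mono[of 0 "\<bar>y\<bar>"] power_grad_mono[of "-\<bar>y\<bar>" 0] by auto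
    then have "0 \<le> s * power_grad p c \<bar>y\<bar>" "s * power_grad p c (- \<bar>y\<bar>) \<le> 0"
      using s by (auto intro: mult_nonneg_nonneg mult_nonneg_nonpos)
    then have "?f (- \<bar>y\<bar>) \<le> y" "y \<le> ?f \<bar>y\<bar>"
      by linarith+
    moreover have "continuous_on {- \<bar>y\<bar>..\<bar>y\<bar>} ?f"
      by (intro continuous_intros continuous_on_power_grad)
    ultimately have "\<exists>x\<ge>- \<bar>y\<bar>. x \<le> \<bar>y\<bar> \<and> ?f x = y"
      by (intro IVT') simp_all
    then show "\<exists>x. ?f x = y" by blast
  qed
qed

lemma normal_map_resolvent: "s \<ge> 0 \<Longrightarrow> resolvent p c s y + s * power_grad p c (resolvent p c s y) = y"
  using surj_f_inv_f[OF bij_is_surj[OF bij_normal_map[of s]], of y] by (simp add: resolvent_def)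

lemma resolvent_eqI: "s \<ge> 0 \<Longrightarrow> x + s * power_grad p c x = y \<Longrightarrow> resolvent p c s y = x"
  using injD[OF bij_is_inj[OF bij_normal_map[of s]], of "resolvent p c s y" x] normal_map_resolvent[of s y]
  by simp

lemma resolvent_le_iff: "s \<ge> 0 \<Longrightarrow> resolvent p c s y \<le> x \<longleftrightarrow> y \<le> x + s * power_grad p c x"
  using strict_mono_less_eq[OF strict_mono_normal_map[of s], of "resolvent p c s y" x]
    normal_map_resolvent[of s y] by simp

text \<open>Joint measurability in \<open>s\<close> and \<open>y\<close>: monotonicity of the normal
  map turns a sublevel set of the implicitly defined resolvent into an explicit inequality between
  \<open>s\<close> and \<open>y\<close>.\<close>

lemma borel_measurable_resolvent:
  "(\<lambda>(s, y). resolvent p c s y) \<in> borel_measurable (borel \<Otimes>\<^sub>M borel)"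
proof (subst borel_measurable_iff_le, rule allI)
  fix x :: real
  have *: "resolvent p c s y = resolvent p c (max 0 s) y" for s y by (simp add: resolvent_def)
  have "{w \<in> space (borel \<Otimes>\<^sub>M borel). (case w of (s, y) \<Rightarrow> resolvent p c s y) \<le> x} =
     {w \<in> space (borel \<Otimes>\<^sub>M borel). snd w \<le> x + max 0 (fst w) * power_grad p c x}"
    by (subst *) (auto simp: resolvent_le_iff)
  also have "\<dots> \<in> sets (borel \<Otimes>\<^sub>M borel)" by measurable
  finally show "{w \<in> space (borel \<Otimes>\<^sub>M borel). (case w of (s, y) \<Rightarrow> resolvent p c s y) \<le> x} \<in> sets (borel \<Otimes>\<^sub>M borel)" .
qed

lemma resolvent_0: "resolvent p c 0 y = y"
  by (rule resolvent_eqI) auto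

lemma resolvent_eq_0_iff: "s \<ge> 0 \<Longrightarrow> resolvent p c s y = 0 \<longleftrightarrow> y = 0"
  using normal_map_resolvent[of s y] resolvent_eqI[of s 0 y] by auto

lemma resolvent_nonneg: "s \<ge> 0 \<Longrightarrow> 0 \<le> y \<Longrightarrow> 0 \<le> resolvent p c s y"
  using resolvent_le_iff[of s y 0] resolvent_eq_0_iff[of s y] by (cases "y = 0") auto

lemma power_grad_uminus: "power_grad p c (- x) = - power_grad p c x"
  by (simp add: power_grad_def sgn_minus)

lemma resolvent_uminus: "s \<ge> 0 \<Longrightarrow> resolvent p c s (- y) = - resolvent p c s y"
  using normal_map_resolvent[of s y] by (intro resolvent_eqI) (auto simp: power_grad_uminus algebra_simps)

lemma abs_resolvent_le: assumes s: "s \<ge> 0" shows "\<bar>resolvent p c s y\<bar> \<le> \<bar>y\<bar>"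
proof -
  have *: "0 \<le> resolvent p c s y \<and> resolvent p c s y \<le> y" if "y \<ge> 0" for y
    using resolvent_nonneg[OF s that] power_grad_mono[OF that] s resolvent_le_iff[OF s, of y y] by simp
  show ?thesis
    using *[of y] *[of "-y"] resolvent_uminus[OF s, of y] by (cases "y \<ge> 0") auto
qed

text \<open>Subtracting the defining equations for \<open>s\<close> and \<open>t\<close> isolates
  the difference of the resolvents. The bound gives the continuity in \<open>s\<close> that the
  inverse function rule asks for.\<close>

lemma resolvent_lipschitz:
  assumes s: "s \<ge> 0" "t \<ge> 0"
  shows "\<bar>resolvent p c s y - resolvent p c t y\<bar> \<le> \<bar>s - t\<bar> * \<bar>power_grad p c y\<bar>"
proof -
  define x x' where "x = resolvent p c s y" "x' = resolvent p c t y"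
  define D where "D = power_grad p c x - power_grad p c x'"
  have "x + s * power_grad p c x = x' + t * power_grad p c x'"
    unfolding x_x'_def using s normal_map_resolvent by simp
  then have eq: "(x - x') + s * D = (t - s) * power_grad p c x'"
    by (simp add: D_def algebra_simps)
  \<comment> \<open>\<open>D\<close> has the sign of \<open>x - x'\<close> by monotonicity, so
    adding \<open>s * D\<close> cannot shrink the absolute value.\<close>
  have "\<bar>x - x'\<bar> \<le> \<bar>(x - x') + s * D\<bar>"
  proof (cases "x \<ge> x'")
    case True
    then have "s * D \<ge> 0" using power_grad_mono[of x' x] s by (simp add: D_def)
    with True show ?thesis by linarith
  next
    case False
    then have "s * D \<le> 0" using power_grad_mono[of x x'] s by (simp add: D_def mult_nonneg_nonpos)
    with False show ?thesis by linarith
  qed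
  also have "\<dots> = \<bar>t - s\<bar> * \<bar>power_grad p c x'\<bar>" unfolding eq by (simp add: abs_mult)
  also have "\<dots> \<le> \<bar>t - s\<bar> * \<bar>power_grad p c y\<bar>"
    unfolding x_x'_def using s by (intro mult_left_mono abs_power_grad_mono abs_resolvent_le) auto
  finally show ?thesis unfolding x_x'_def by (simp add: abs_minus_commute)
qed

lemma continuous_on_resolvent: "continuous_on {0..} (\<lambda>s. resolvent p c s y)"
proof (rule lipschitz_on_continuous_on)
  show "\<bar>power_grad p c y\<bar>-lipschitz_on {0..} (\<lambda>s. resolvent p c s y)"
    by (rule lipschitz_onI) (use resolvent_lipschitz in \<open>auto simp: dist_real_def mult.commute\<close>)
qed

text \<open>For fixed \<open>y\<close> the parameter is an explicit function of the resolvent value,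
  \<open>s = (y - x) / power_grad p c x\<close>. Its derivative is inverted;
  \<open>y \<noteq> 0\<close> keeps \<open>x\<close> away from 0, where the denominator
  vanishes.\<close>

lemma DERIV_resolvent:
  assumes s: "s > 0" and y: "y \<noteq> 0"
  defines "x \<equiv> resolvent p c s y"
  shows "((\<lambda>s. resolvent p c s y) has_real_derivative - power_grad p c x / (1 + s * power_hess p c x)) (at s)"
proof -
  have x: "x \<noteq> 0" using s y resolvent_eq_0_iff[of s y] by (simp add: x_def)
  then have g: "power_grad p c x \<noteq> 0" by (simp add: power_grad_eq_0_iff)
  have yx: "y - x = s * power_grad p c x" using normal_map_resolvent[of s y] s by (simp add: x_def)
  have h: "1 + s * power_hess p c x > 0" using power_hess_nonneg[of x] s by (intro add_pos_nonneg) auto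
  have "((\<lambda>x. (y - x) / power_grad p c x) has_real_derivative
      ((0 - 1) * power_grad p c x - (y - x) * power_hess p c x) / (power_grad p c x * power_grad p c x)) (at x)"
    by (intro DERIV_power_grad p x g DERIV_ident DERIV_const DERIV_divide DERIV_diff)
  also have "((0 - 1) * power_grad p c x - (y - x) * power_hess p c x) / (power_grad p c x * power_grad p c x)
     = - (1 + s * power_hess p c x) / power_grad p c x"
    unfolding yx using g by (simp add: field_simps)
  finally have d: "((\<lambda>x. (y - x) / power_grad p c x) has_real_derivative - (1 + s * power_hess p c x) / power_grad p c x)
      (at (resolvent p c s y))" by (simp add: x_def)
  have "((\<lambda>s. resolvent p c s y) has_real_derivative inverse (- (1 + s * power_hess p c x) / power_grad p c x)) (at s)"
  proof (rule DERIV_inverse_function[where a = 0 and b = "s + 1" and g = "\<lambda>s. resolvent p c s y"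
        and f = "\<lambda>x. (y - x) / power_grad p c x"])
    show "((\<lambda>x. (y - x) / power_grad p c x) has_real_derivative - (1 + s * power_hess p c x) / power_grad p c x)
      (at (resolvent p c s y))" by (rule d)
    show "- (1 + s * power_hess p c x) / power_grad p c x \<noteq> 0" using h g by auto
    show "isCont (\<lambda>s. resolvent p c s y) s"
      using continuous_on_interior[OF continuous_on_resolvent[of y], of s] s by simp
    fix t :: real assume t: "0 < t"
    then have "power_grad p c (resolvent p c t y) \<noteq> 0"
      using y resolvent_eq_0_iff[of t y] by (simp add: power_grad_eq_0_iff)
    moreover have "y - resolvent p c t y = t * power_grad p c (resolvent p c t y)"
      using normal_map_resolvent[of t y] t by simp
    ultimately show "(y - resolvent p c t y) / power_grad p c (resolvent p c t y) = t" by simp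
  qed (use s in auto)
  also have "inverse (- (1 + s * power_hess p c x) / power_grad p c x) = - power_grad p c x / (1 + s * power_hess p c x)"
    by (simp only: divide_minus_left inverse_minus_eq inverse_divide)
  finally show ?thesis .
qed

text \<open>The one-dimensional hypothesis of \<open>lborel_distr_coordinatewise\<close>. The normal
  map fixes 0, so it is a bijection of the nonzero reals, where it is differentiable; the removed
  point is null on both sides.\<close>

lemma nn_integral_normal_map:
  assumes s: "s \<ge> 0" and le: "l \<le> u"
  shows "(\<integral>\<^sup>+x. ennreal (1 + s * power_hess p c x) * indicator {l<..<u} (x + s * power_grad p c x) \<partial>lborel) = ennreal (u - l)"
proof -
  let ?f = "\<lambda>x. x + s * power_grad p c x"
  have im: "?f ` (- {0}) = - {0}"
  proof -
    have "?f ` (- {0}) = - {?f 0}"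
      using bij_image_Compl_eq[OF bij_normal_map[OF s], of "{0}"] by simp
    then show ?thesis by simp
  qed
  have pos: "1 + s * power_hess p c x \<ge> 0" for x using s power_hess_nonneg[of x] by simp
  have "(\<integral>\<^sup>+x. ennreal (1 + s * power_hess p c x) * indicator {l<..<u} (?f x) \<partial>lborel)
    = (\<integral>\<^sup>+x. ennreal \<bar>1 + s * power_hess p c x\<bar> * indicator {l<..<u} (?f x) * indicator (- {0}) x \<partial>lborel)"
  proof (rule nn_integral_cong_AE)
    show "AE x in lborel. ennreal (1 + s * power_hess p c x) * indicator {l<..<u} (?f x) =
        ennreal \<bar>1 + s * power_hess p c x\<bar> * indicator {l<..<u} (?f x) * indicator (- {0}) x"
      using AE_lborel_singleton[of 0] by eventually_elim (use pos in \<open>simp del: abs_of_nonneg add: abs_of_nonneg[OF pos]\<close>)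
  qed
  also have "\<dots> = (\<integral>\<^sup>+y. indicator {l<..<u} y * indicator (?f ` (- {0})) y \<partial>lborel)"
  proof (rule nn_integral_change_of_variables_real)
    show "inj_on ?f (- {0})" by (rule inj_on_subset[OF bij_is_inj[OF bij_normal_map[OF s]] subset_UNIV])
    show "(?f has_real_derivative 1 + s * power_hess p c x) (at x within - {0})" if "x \<in> - {0}" for x
      by (rule has_field_derivative_at_within, intro DERIV_add DERIV_ident DERIV_cmult DERIV_power_grad)
        (use that p in auto)
  qed (auto simp: im)
  also have "\<dots> = (\<integral>\<^sup>+y. indicator {l<..<u} y \<partial>lborel)"
    unfolding im
  proof (rule nn_integral_cong_AE)
    show "AE y in lborel. indicator {l<..<u} y * indicator (- {0}) y = (indicator {l<..<u} y :: ennreal)"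
      using AE_lborel_singleton[of 0] by eventually_elim simp
  qed
  also have "\<dots> = ennreal (u - l)" using le by simp
  finally show ?thesis .
qed

end

section \<open>Sublevel sets and their normal map\<close>

definition power_sum :: "real \<Rightarrow> ('n::finite \<Rightarrow> real) \<Rightarrow> real ^ 'n \<Rightarrow> real" where
  "power_sum p c x = (\<Sum>r\<in>UNIV. c r * \<bar>x $ r\<bar> powr p)"

definition power_normal :: "real \<Rightarrow> ('n::finite \<Rightarrow> real) \<Rightarrow> real ^ 'n \<Rightarrow> real ^ 'n" where
  "power_normal p c x = (\<chi> r. power_grad p (c r) (x $ r))"

definition vec_resolvent :: "real \<Rightarrow> ('n::finite \<Rightarrow> real) \<Rightarrow> real \<Rightarrow> real ^ 'n \<Rightarrow> real ^ 'n" where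
  "vec_resolvent p c s y = (\<chi> r. resolvent p (c r) s (y $ r))"

text \<open>Minus the derivative of \<open>F\<close> at the foot point \<open>vec_resolvent p c s y\<close> with respect to \<open>s\<close>.\<close>

definition speed :: "real \<Rightarrow> ('n::finite \<Rightarrow> real) \<Rightarrow> real \<Rightarrow> real ^ 'n \<Rightarrow> real" where
  "speed p c s x = p * (\<Sum>i\<in>UNIV. (power_grad p (c i) (x $ i))\<^sup>2 / (1 + s * power_hess p (c i) (x $ i)))"

lemma AE_lborel_vec_nth_neq: "AE y in lborel. (y :: real ^ 'n) $ r \<noteq> a"
proof -
  have "negligible {y :: real ^ 'n. axis r 1 \<bullet> y = a}"
    by (rule negligible_hyperplane) (simp add: axis_eq_0_iff)
  then have "{y :: real ^ 'n. y $ r = a} \<in> null_sets lebesgue"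
    by (simp add: negligible_iff_null_sets inner_axis')
  moreover have "{y :: real ^ 'n. y $ r = a} \<in> sets lborel" by simp
  ultimately have "{y :: real ^ 'n. y $ r = a} \<in> null_sets lborel"
    by (simp add: null_sets_completion_iff)
  then show ?thesis by (rule AE_I') auto
qed

lemma AE_lborel_vec_nonzero: "AE y in lborel. \<forall>r. (y :: real ^ 'n) $ r \<noteq> 0"
proof -
  have "AE y :: real ^ 'n in lborel. \<forall>r\<in>UNIV. y $ r \<noteq> 0"
    by (rule AE_finite_allI) (simp_all add: AE_lborel_vec_nth_neq)
  then show ?thesis by simp
qed

lemma borel_measurable_power_sum [measurable]: "power_sum p c \<in> borel_measurable borel"
  unfolding power_sum_def by measurable

lemma borel_measurable_power_normal [measurable]: "power_normal p c \<in> borel_measurable borel"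
  unfolding power_normal_def by measurable

lemma power_sum_scaleR: "0 < t \<Longrightarrow> power_sum p c (t *\<^sub>R x) = t powr p * power_sum p c x"
  by (simp add: power_sum_def sum_distrib_left abs_mult powr_mult mult_ac)

lemma norm_power_normal_sq: "(norm (power_normal p c x))\<^sup>2 = (\<Sum>r\<in>UNIV. (power_grad p (c r) (x $ r))\<^sup>2)"
  by (simp add: power_normal_def power2_norm_eq_inner inner_vec_def) (simp add: power2_eq_square)

lemma borel_measurable_speed [measurable (raw)]:
  assumes [measurable]: "f \<in> borel_measurable M" "g \<in> borel_measurable M"
  shows "(\<lambda>w. speed p c (f w) (g w)) \<in> borel_measurable M"
  unfolding speed_def by measurable

context
  fixes p :: real and c :: "'n::finite \<Rightarrow> real"
  assumes p: "1 < p" and c: "\<And>r. 0 < c r"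
begin

lemma power_sum_pos: "x \<noteq> 0 \<Longrightarrow> 0 < power_sum p c x"
proof -
  assume "x \<noteq> 0"
  then obtain r where "x $ r \<noteq> 0" by (auto simp: vec_eq_iff)
  then have "0 < c r * \<bar>x $ r\<bar> powr p" using c[of r] by simp
  also have "\<dots> \<le> power_sum p c x"
    unfolding power_sum_def using c by (intro member_le_sum) (simp_all add: less_imp_le)
  finally show ?thesis .
qed

lemma continuous_on_power_sum: "continuous_on A (power_sum p c)"
  unfolding power_sum_def using p by (intro continuous_intros continuous_on_powr') auto

lemma power_sum_eq_inner: "power_sum p c x = power_normal p c x \<bullet> x"
  using power_grad_mult_self[OF p] by (simp add: power_sum_def power_normal_def inner_vec_def)

lemma power_sum_tangent: "power_sum p c z \<ge> power_sum p c x + p * (power_normal p c x \<bullet> (z - x))"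
proof -
  have "power_sum p c x + p * (power_normal p c x \<bullet> (z - x)) =
     (\<Sum>r\<in>UNIV. c r * \<bar>x $ r\<bar> powr p + p * power_grad p (c r) (x $ r) * (z $ r - x $ r))"
    by (simp add: power_sum_def power_normal_def inner_vec_def sum.distrib sum_distrib_left mult_ac)
  also have "\<dots> \<le> power_sum p c z"
    unfolding power_sum_def by (intro sum_mono power_tangent p c)
  finally show ?thesis .
qed

text \<open>By convexity \<open>z\<close> lies in the half-space
  \<open>g(x) \<bullet> (z - x) \<le> 0\<close>. Hence the cross term is nonnegative when the
  squared distance from \<open>x + s g(x)\<close> to \<open>z\<close> is expanded.\<close>

lemma nearest_point:
  assumes "power_sum p c z \<le> power_sum p c x" "0 \<le> s"
  shows "s * norm (power_normal p c x) \<le> dist (x + s *\<^sub>R power_normal p c x) z"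
proof -
  let ?g = "power_normal p c x"
  have "p * (?g \<bullet> (z - x)) \<le> 0"
    using power_sum_tangent[of x z] assms(1) by linarith
  then have "?g \<bullet> (z - x) \<le> 0" using p by (simp add: mult_le_0_iff)
  then have "s * (?g \<bullet> (x - z)) \<ge> 0" using assms(2) by (simp add: inner_diff_right)
  moreover have "(norm (s *\<^sub>R ?g + (x - z)))\<^sup>2 = (s * norm ?g)\<^sup>2 + (norm (x - z))\<^sup>2 + 2 * (s * (?g \<bullet> (x - z)))"
  proof -
    have "(norm (v + w))\<^sup>2 = (norm v)\<^sup>2 + (norm w)\<^sup>2 + 2 * (v \<bullet> w)" for v w :: "real ^ 'n"
      by (simp add: power2_norm_eq_inner inner_add_left inner_add_right inner_commute[of w v])
    from this[of "s *\<^sub>R ?g" "x - z"] assms(2) show ?thesis by simp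
  qed
  ultimately have "(s * norm ?g)\<^sup>2 \<le> (norm (s *\<^sub>R ?g + (x - z)))\<^sup>2"
    by simp
  then have "s * norm ?g \<le> norm (s *\<^sub>R ?g + (x - z))"
    by (rule power2_le_imp_le) simp
  then show ?thesis by (simp add: dist_norm algebra_simps)
qed

text \<open>Dilation by \<open>u powr (- 1 / p)\<close> carries \<open>{F \<le> u}\<close> to the
  fixed body. The dilated \<open>x\<close> gives the upper bound; for the lower one, a point of the
  body is scaled back into \<open>{F \<le> u}\<close> and compared by
  \<open>nearest_point\<close>.\<close>

lemma infdist_sublevel:
  assumes "0 \<le> s" "x \<noteq> 0"
  defines "u \<equiv> power_sum p c x"
  shows "infdist (u powr (- 1 / p) *\<^sub>R (x + s *\<^sub>R power_normal p c x)) {z. power_sum p c z \<le> 1}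
    = s * norm (power_normal p c x) * u powr (- 1 / p)"
proof -
  let ?g = "power_normal p c x" and ?K = "{z. power_sum p c z \<le> 1}"
  define t where "t = u powr (- 1 / p)"
  have u: "u > 0" using power_sum_pos assms by (simp add: u_def)
  then have t: "t > 0" by (simp add: t_def)
  have "t powr p = u powr (- 1 / p * p)" unfolding t_def by (rule powr_powr)
  also have "\<dots> = 1 / u" using p u by (simp add: powr_minus_divide)
  finally have tp: "t powr p = 1 / u" .
  have mem: "t *\<^sub>R x \<in> ?K" using u by (simp add: power_sum_scaleR[OF t] tp u_def[symmetric])
  show ?thesis
    unfolding t_def[symmetric]
  proof (rule antisym)
    have "infdist (t *\<^sub>R (x + s *\<^sub>R ?g)) ?K \<le> dist (t *\<^sub>R (x + s *\<^sub>R ?g)) (t *\<^sub>R x)"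
      using mem by (rule infdist_le)
    also have "\<dots> = s * norm ?g * t"
      using t assms(1) by (simp add: dist_norm scaleR_add_right)
    finally show "infdist (t *\<^sub>R (x + s *\<^sub>R ?g)) ?K \<le> s * norm ?g * t" .
  next
    have "s * norm ?g * t \<le> dist (t *\<^sub>R (x + s *\<^sub>R ?g)) z" if z: "z \<in> ?K" for z
    proof -
      have "(1 / t) powr p = u" using t tp by (simp add: powr_divide)
      then have "power_sum p c ((1 / t) *\<^sub>R z) = u * power_sum p c z"
        using power_sum_scaleR[of "1 / t" p c z] t by simp
      also have "\<dots> \<le> u * 1" using z u by (intro mult_left_mono) auto
      finally have "power_sum p c ((1 / t) *\<^sub>R z) \<le> u" by simp
      then have "s * norm ?g \<le> dist (x + s *\<^sub>R ?g) ((1 / t) *\<^sub>R z)"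
        unfolding u_def using assms(1) by (rule nearest_point)
      then have "t * (s * norm ?g) \<le> t * dist (x + s *\<^sub>R ?g) ((1 / t) *\<^sub>R z)"
        using t by (intro mult_left_mono) auto
      also have "\<dots> = dist (t *\<^sub>R (x + s *\<^sub>R ?g)) (t *\<^sub>R (1 / t) *\<^sub>R z)"
        unfolding dist_norm scaleR_diff_right[symmetric] using t by simp
      also have "t *\<^sub>R (1 / t) *\<^sub>R z = z" using t by simp
      finally show ?thesis by (simp add: mult_ac)
    qed
    then show "s * norm ?g * t \<le> infdist (t *\<^sub>R (x + s *\<^sub>R ?g)) ?K"
      using mem by (subst infdist_notempty) (blast, blast intro: cINF_greatest)
  qed
qed

section \<open>Foot points and their level as a function of s\<close>

lemma vec_resolvent_eq: "0 \<le> s \<Longrightarrow> vec_resolvent p c s y + s *\<^sub>R power_normal p c (vec_resolvent p c s y) = y"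
  using normal_map_resolvent[OF p c] by (simp add: vec_eq_iff vec_resolvent_def power_normal_def)

lemma vec_resolvent_normal_map: "0 \<le> s \<Longrightarrow> vec_resolvent p c s (x + s *\<^sub>R power_normal p c x) = x"
  using resolvent_eqI[OF p c] by (simp add: vec_eq_iff vec_resolvent_def power_normal_def)

lemma measurable_vec_resolvent [measurable (raw)]:
  assumes [measurable]: "f \<in> borel_measurable M" "g \<in> borel_measurable M"
  shows "(\<lambda>w. vec_resolvent p c (f w) (g w)) \<in> borel_measurable M"
proof -
  have "(\<lambda>w. resolvent p (c r) (f w) (g w $ r)) \<in> borel_measurable M" for r
    using measurable_compose[OF _ borel_measurable_resolvent[OF p c[of r]], of "\<lambda>w. (f w, g w $ r)" M] by simp
  then show ?thesis unfolding vec_resolvent_def by measurable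
qed

text \<open>Forces the level of the foot point to 0 as \<open>s\<close> grows. By Euler's identity
  \<open>s * F(x)\<close> is the inner product of \<open>s g(x) = y - x\<close> with
  \<open>x\<close>, and each coordinate satisfies \<open>(y - x) * x \<le> y^2\<close>.\<close>

lemma power_sum_vec_resolvent_le:
  assumes s: "0 < s"
  shows "power_sum p c (vec_resolvent p c s y) \<le> (\<Sum>r\<in>UNIV. (y $ r)\<^sup>2) / s"
proof -
  let ?x = "\<lambda>r. resolvent p (c r) s (y $ r)"
  have "s * power_sum p c (vec_resolvent p c s y) = (\<Sum>r\<in>UNIV. (s * power_grad p (c r) (?x r)) * ?x r)"
    by (simp add: power_sum_eq_inner inner_vec_def vec_resolvent_def power_normal_def sum_distrib_left mult_ac)
  also have "\<dots> \<le> (\<Sum>r\<in>UNIV. (y $ r)\<^sup>2)"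
  proof (rule sum_mono)
    fix r
    have "s * power_grad p (c r) (?x r) = y $ r - ?x r"
      using normal_map_resolvent[OF p c, of s r "y $ r"] s by simp
    then have "(s * power_grad p (c r) (?x r)) * ?x r = (y $ r - ?x r) * ?x r" by (rule arg_cong)
    also have "\<dots> = y $ r * ?x r - (?x r)\<^sup>2" by (simp add: algebra_simps power2_eq_square)
    also have "\<dots> \<le> \<bar>y $ r\<bar> * \<bar>?x r\<bar>"
      unfolding abs_mult[symmetric] using abs_ge_self[of "y $ r * ?x r"] zero_le_power2[of "?x r"] by linarith
    also have "\<dots> \<le> \<bar>y $ r\<bar> * \<bar>y $ r\<bar>"
      using abs_resolvent_le[OF p c] s by (intro mult_left_mono) auto
    finally show "(s * power_grad p (c r) (?x r)) * ?x r \<le> (y $ r)\<^sup>2" by (simp add: power2_eq_square)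
  qed
  finally show ?thesis using s by (simp add: field_simps)
qed

lemma one_plus_hess_pos: "0 \<le> s \<Longrightarrow> 0 < 1 + s * power_hess p (c r) x"
  using power_hess_nonneg[OF p c, of r x] by (intro add_pos_nonneg) auto

lemma speed_pos: "0 \<le> s \<Longrightarrow> x \<noteq> 0 \<Longrightarrow> 0 < speed p c s x"
proof -
  assume s: "0 \<le> s" and "x \<noteq> 0"
  then obtain r where "x $ r \<noteq> 0" by (auto simp: vec_eq_iff)
  then have "0 < (power_grad p (c r) (x $ r))\<^sup>2 / (1 + s * power_hess p (c r) (x $ r))"
    using one_plus_hess_pos[OF s, of r "x $ r"] power_grad_eq_0_iff[OF p c] by simp
  also have "\<dots> \<le> (\<Sum>i\<in>UNIV. (power_grad p (c i) (x $ i))\<^sup>2 / (1 + s * power_hess p (c i) (x $ i)))"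
    using one_plus_hess_pos[OF s] by (intro member_le_sum) (simp_all add: less_imp_le)
  finally show ?thesis using p by (simp add: speed_def)
qed

lemma DERIV_power_sum_resolvent:
  assumes s: "0 < s" and y: "\<And>r. y $ r \<noteq> 0"
  shows "((\<lambda>s. power_sum p c (vec_resolvent p c s y)) has_real_derivative - speed p c s (vec_resolvent p c s y)) (at s)"
proof -
  let ?x = "\<lambda>r. resolvent p (c r) s (y $ r)"
  have "((\<lambda>s. c r * \<bar>resolvent p (c r) s (y $ r)\<bar> powr p) has_real_derivative
      p * power_grad p (c r) (?x r) * (- power_grad p (c r) (?x r) / (1 + s * power_hess p (c r) (?x r)))) (at s)" for r
    by (rule DERIV_chain2[OF DERIV_abs_powr[OF p c] DERIV_resolvent[OF p c s y]])
  then have "((\<lambda>s. power_sum p c (vec_resolvent p c s y)) has_real_derivative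
      (\<Sum>r\<in>UNIV. p * power_grad p (c r) (?x r) * (- power_grad p (c r) (?x r) / (1 + s * power_hess p (c r) (?x r))))) (at s)"
    unfolding power_sum_def vec_resolvent_def vec_lambda_beta by (rule DERIV_sum)
  also have "(\<Sum>r\<in>UNIV. p * power_grad p (c r) (?x r) * (- power_grad p (c r) (?x r) / (1 + s * power_hess p (c r) (?x r))))
     = - speed p c s (vec_resolvent p c s y)"
    by (simp add: speed_def vec_resolvent_def sum_distrib_left sum_negf power2_eq_square mult_ac)
  finally show ?thesis .
qed

lemma continuous_on_power_sum_resolvent: "continuous_on {0..} (\<lambda>s. power_sum p c (vec_resolvent p c s y))"
proof (rule continuous_on_compose2[OF continuous_on_power_sum[of UNIV]])
  show "continuous_on {0..} (\<lambda>s. vec_resolvent p c s y)"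
    unfolding vec_resolvent_def by (rule continuous_on_vec_lambda) (rule continuous_on_resolvent[OF p c])
qed simp

lemma power_sum_resolvent_strict_antimono:
  assumes y: "\<And>r. y $ r \<noteq> 0" and st: "0 \<le> s" "s < t"
  shows "power_sum p c (vec_resolvent p c t y) < power_sum p c (vec_resolvent p c s y)"
proof (rule DERIV_neg_imp_decreasing_open[OF st(2)])
  show "continuous_on {s..t} (\<lambda>s. power_sum p c (vec_resolvent p c s y))"
    by (rule continuous_on_subset[OF continuous_on_power_sum_resolvent]) (use st in auto)
  fix w assume "s < w" "w < t"
  moreover from this have "vec_resolvent p c w y \<noteq> 0"
    using y resolvent_eq_0_iff[OF p c, of w] st by (auto simp: vec_eq_iff vec_resolvent_def)
  ultimately show "\<exists>d. ((\<lambda>s. power_sum p c (vec_resolvent p c s y)) has_real_derivative d) (at w) \<and> d < 0"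
    using DERIV_power_sum_resolvent[of w y] y speed_pos[of w] st
    by (intro exI[of _ "- speed p c w (vec_resolvent p c w y)"]) auto
qed

text \<open>The level starts at \<open>F y\<close> for \<open>s = 0\<close>, decreases strictly and
  tends to 0, so the intermediate value theorem yields exactly this interval.\<close>

lemma power_sum_resolvent_image:
  assumes y: "\<And>r. y $ r \<noteq> 0"
  shows "(\<lambda>s. power_sum p c (vec_resolvent p c s y)) ` {0<..} = {0<..<power_sum p c y}"
proof -
  let ?f = "\<lambda>s. power_sum p c (vec_resolvent p c s y)"
  have f0: "?f 0 = power_sum p c y"
    using resolvent_0[OF p c] by (simp add: vec_resolvent_def)
  have nz: "vec_resolvent p c s y \<noteq> 0" if "s \<ge> 0" for s
    using y resolvent_eq_0_iff[OF p c, of s] that by (auto simp: vec_eq_iff vec_resolvent_def)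
  show ?thesis
  proof (intro equalityI subsetI)
    fix u assume "u \<in> ?f ` {0<..}"
    then show "u \<in> {0<..<power_sum p c y}"
      using power_sum_resolvent_strict_antimono[OF y, of 0] f0 nz power_sum_pos by auto
  next
    fix u assume u: "u \<in> {0<..<power_sum p c y}"
    \<comment> \<open>Chosen so that the decay bound at \<open>S\<close> is at most
      \<open>u\<close>; the summand 1 keeps \<open>S\<close> positive.\<close>
    define S where "S = (\<Sum>r\<in>UNIV. (y $ r)\<^sup>2) / u + 1"
    have Y: "(\<Sum>r\<in>UNIV. (y $ r)\<^sup>2) \<ge> 0" by (intro sum_nonneg) simp
    then have S: "S > 0" using u by (simp add: S_def add_nonneg_pos)
    have "(\<Sum>r\<in>UNIV. (y $ r)\<^sup>2) \<le> u * S" using u by (simp add: S_def field_simps)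
    then have "(\<Sum>r\<in>UNIV. (y $ r)\<^sup>2) / S \<le> u" using S by (simp add: field_simps)
    then have "?f S \<le> u" using power_sum_vec_resolvent_le[OF S, of y] by linarith
    moreover have "u \<le> ?f 0" using u f0 by simp
    moreover have "continuous_on {0..S} ?f"
      by (rule continuous_on_subset[OF continuous_on_power_sum_resolvent]) auto
    ultimately have "\<exists>s\<ge>0. s \<le> S \<and> ?f s = u"
      using S by (intro IVT2') simp_all
    then obtain s where s: "s \<ge> 0" "?f s = u" by blast
    then have "s \<noteq> 0" using u f0 by auto
    then show "u \<in> ?f ` {0<..}" using s by auto
  qed
qed

section \<open>The two substitutions and their combination by Tonelli's theorem\<close>

lemma sublevel_scaled_iff:
  assumes "0 < u"
  shows "power_sum p c (u powr (- 1 / p) *\<^sub>R y) \<le> 1 \<longleftrightarrow> power_sum p c y \<le> u"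
proof -
  have "(u powr (- 1 / p)) powr p = u powr (- 1 / p * p)" by (rule powr_powr)
  also have "\<dots> = 1 / u" using p assms by (simp add: powr_minus_divide)
  finally show ?thesis using assms by (simp add: power_sum_scaleR)
qed

text \<open>For fixed \<open>y\<close>, the substitution \<open>u = F (X s)\<close>. Lying outside
  \<open>{F \<le> u}\<close> means \<open>u < F y\<close>, which is exactly the range of levels for
  \<open>s > 0\<close>, and the distance becomes explicit through the foot point.\<close>

lemma nn_integral_radial_substitution:
  assumes y: "\<And>r. y $ r \<noteq> 0"
    and [measurable]: "case_prod h \<in> borel_measurable (borel \<Otimes>\<^sub>M borel)"
  defines "K \<equiv> {z. power_sum p c z \<le> 1}"
  defines "X \<equiv> \<lambda>s. vec_resolvent p c s y"
  shows "(\<integral>\<^sup>+u. h u (infdist (u powr (- 1 / p) *\<^sub>R y) K) * indicator (- K) (u powr (- 1 / p) *\<^sub>R y) * indicator {0<..} u \<partial>lborel)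
    = (\<integral>\<^sup>+s. ennreal (speed p c s (X s)) *
        h (power_sum p c (X s)) (s * norm (power_normal p c (X s)) * power_sum p c (X s) powr (- 1 / p)) * indicator {0<..} s \<partial>lborel)"
proof -
  let ?f = "\<lambda>s. power_sum p c (X s)"
  define H where "H = (\<lambda>u. h u (infdist (u powr (- 1 / p) *\<^sub>R y) K))"
  have nz: "X s \<noteq> 0" if "s \<ge> 0" for s
    using y resolvent_eq_0_iff[OF p c, of s] that by (auto simp: vec_eq_iff vec_resolvent_def X_def)
  have im: "?f ` {0<..} = {0<..<power_sum p c y}"
    unfolding X_def by (rule power_sum_resolvent_image) (rule y)
  have inf [measurable]: "(\<lambda>z. infdist z K) \<in> borel_measurable borel"
    by (intro borel_measurable_continuous_onI continuous_intros)
  have [measurable]: "X \<in> borel_measurable borel" unfolding X_def by measurable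
  have [measurable]: "H \<in> borel_measurable borel"
    unfolding H_def by measurable
  have "(\<integral>\<^sup>+u. h u (infdist (u powr (- 1 / p) *\<^sub>R y) K) * indicator (- K) (u powr (- 1 / p) *\<^sub>R y) * indicator {0<..} u \<partial>lborel)
     = (\<integral>\<^sup>+u. H u * indicator {0<..<power_sum p c y} u \<partial>lborel)"
  proof (intro nn_integral_cong)
    fix u :: real
    have "u powr (- 1 / p) *\<^sub>R y \<in> - K \<longleftrightarrow> u < power_sum p c y" if "0 < u"
      using sublevel_scaled_iff[OF that, of y] by (simp add: K_def flip: not_le)
    then show "h u (infdist (u powr (- 1 / p) *\<^sub>R y) K) * indicator (- K) (u powr (- 1 / p) *\<^sub>R y) * indicator {0<..} u
      = H u * indicator {0<..<power_sum p c y} u"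
      by (cases "0 < u") (simp_all add: H_def indicator_def)
  qed
  also have "\<dots> = (\<integral>\<^sup>+s. ennreal \<bar>- speed p c s (X s)\<bar> * H (?f s) * indicator {0<..} s \<partial>lborel)"
  proof (subst im[symmetric], rule nn_integral_change_of_variables_real[symmetric])
    show "?f ` {0<..} \<in> sets borel" unfolding im by simp
    show "inj_on ?f {0<..}"
    proof (rule linorder_inj_onI)
      fix a b :: real assume "a < b" "a \<in> {0<..}"
      then show "?f a \<noteq> ?f b"
        using power_sum_resolvent_strict_antimono[OF y, of a b] by (simp add: X_def)
    qed auto
    show "(?f has_real_derivative - speed p c s (X s)) (at s within {0<..})" if "s \<in> {0<..}" for s
      unfolding X_def using that
      by (intro has_field_derivative_at_within[OF DERIV_power_sum_resolvent] y) auto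
  qed simp_all
  also have "\<dots> = (\<integral>\<^sup>+s. ennreal (speed p c s (X s)) *
        h (?f s) (s * norm (power_normal p c (X s)) * ?f s powr (- 1 / p)) * indicator {0<..} s \<partial>lborel)"
  proof (intro nn_integral_cong)
    fix s :: real
    show "ennreal \<bar>- speed p c s (X s)\<bar> * H (?f s) * indicator {0<..} s = ennreal (speed p c s (X s)) *
        h (?f s) (s * norm (power_normal p c (X s)) * ?f s powr (- 1 / p)) * indicator {0<..} s"
    proof (cases "s > 0")
      case True
      then have "infdist (?f s powr (- 1 / p) *\<^sub>R y) K = s * norm (power_normal p c (X s)) * ?f s powr (- 1 / p)"
        using infdist_sublevel[of s "X s"] nz[of s] vec_resolvent_eq[of s y] by (simp add: K_def X_def)
      moreover have "speed p c s (X s) \<ge> 0" using speed_pos[of s "X s"] nz[of s] True by simp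
      ultimately show ?thesis by (simp add: H_def)
    qed simp
  qed
  finally show ?thesis .
qed

lemma nn_integral_normal_map_vec:
  assumes s: "0 \<le> s" and [measurable]: "f \<in> borel_measurable borel"
  shows "(\<integral>\<^sup>+y. f y \<partial>lborel) = (\<integral>\<^sup>+x. f (x + s *\<^sub>R power_normal p c x) *
      ennreal (\<Prod>r\<in>UNIV. 1 + s * power_hess p (c r) (x $ r)) \<partial>lborel)"
proof -
  define w where "w = (\<lambda>r x. 1 + s * power_hess p (c r) x)"
  have w: "0 \<le> w r x" for r x
    using one_plus_hess_pos[OF s, of r x] by (simp add: w_def less_imp_le)
  have [measurable]: "w r \<in> borel_measurable borel" for r unfolding w_def by measurable
  have "lborel = distr (density lborel (\<lambda>x::real^'n. \<Prod>r\<in>UNIV. ennreal (w r (x $ r)))) borel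
      (\<lambda>x. \<chi> r. x $ r + s * power_grad p (c r) (x $ r))"
    using nn_integral_normal_map[OF p c s]
    by (intro lborel_distr_coordinatewise[symmetric] w) (simp_all add: w_def)
  also have "(\<lambda>x. \<chi> r. x $ r + s * power_grad p (c r) (x $ r)) = (\<lambda>x. x + s *\<^sub>R power_normal p c x)"
    by (simp add: fun_eq_iff vec_eq_iff power_normal_def)
  finally have "(\<integral>\<^sup>+y. f y \<partial>lborel) = (\<integral>\<^sup>+y. f y \<partial>distr (density lborel (\<lambda>x::real^'n. \<Prod>r\<in>UNIV. ennreal (w r (x $ r)))) borel
      (\<lambda>x. x + s *\<^sub>R power_normal p c x))" by simp
  also have "\<dots> = (\<integral>\<^sup>+x. (\<Prod>r\<in>UNIV. ennreal (w r (x $ r))) * f (x + s *\<^sub>R power_normal p c x) \<partial>lborel)"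
    by (simp add: nn_integral_distr nn_integral_density)
  also have "\<dots> = (\<integral>\<^sup>+x. f (x + s *\<^sub>R power_normal p c x) *
      ennreal (\<Prod>r\<in>UNIV. 1 + s * power_hess p (c r) (x $ r)) \<partial>lborel)"
    by (intro nn_integral_cong, subst prod_ennreal) (simp add: w, simp add: w_def mult.commute)
  finally show ?thesis .
qed

text \<open>The denominator of the i-th summand of \<open>speed\<close> cancels the i-th Jacobian
  factor. This makes the integrand polynomial in \<open>s\<close>, which is the source of the
  polynomial in the Steiner formula.\<close>

lemma speed_times_jacobian:
  assumes s: "0 \<le> s"
  shows "speed p c s x * (\<Prod>r\<in>UNIV. 1 + s * power_hess p (c r) (x $ r)) =
    p * (\<Sum>i\<in>UNIV. (power_grad p (c i) (x $ i))\<^sup>2 * (\<Prod>r\<in>UNIV - {i}. 1 + s * power_hess p (c r) (x $ r)))"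
proof -
  define J where "J = (\<Prod>r\<in>UNIV. 1 + s * power_hess p (c r) (x $ r))"
  have eq: "G / (1 + s * power_hess p (c i) (x $ i)) * J =
      G * (\<Prod>r\<in>UNIV - {i}. 1 + s * power_hess p (c r) (x $ r))" for i G
  proof -
    have "J = (1 + s * power_hess p (c i) (x $ i)) * (\<Prod>r\<in>UNIV - {i}. 1 + s * power_hess p (c r) (x $ r))"
      unfolding J_def by (rule prod.remove) simp_all
    then show ?thesis using one_plus_hess_pos[OF s, of i "x $ i"] by simp
  qed
  have "speed p c s x * J = p * (\<Sum>i\<in>UNIV. (power_grad p (c i) (x $ i))\<^sup>2 / (1 + s * power_hess p (c i) (x $ i)) * J)"
    by (simp only: speed_def sum_distrib_right mult.assoc)
  also have "\<dots> = p * (\<Sum>i\<in>UNIV. (power_grad p (c i) (x $ i))\<^sup>2 * (\<Prod>r\<in>UNIV - {i}. 1 + s * power_hess p (c r) (x $ r)))"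
    by (simp only: eq)
  finally show ?thesis unfolding J_def .
qed

text \<open>Swap \<open>u\<close> and \<open>y\<close>, substitute \<open>u\<close> by
  \<open>s\<close> for almost every \<open>y\<close>, swap \<open>y\<close> and \<open>s\<close>,
  substitute \<open>y\<close> by \<open>x\<close> for each \<open>s > 0\<close>, and swap once more.
  The function \<open>h\<close> stays arbitrary so that different weights and distance bounds can be
  inserted.\<close>

lemma parallel_body_master:
  assumes [measurable]: "case_prod h \<in> borel_measurable (borel \<Otimes>\<^sub>M borel)"
  defines "K \<equiv> {z. power_sum p c z \<le> 1}"
  shows "(\<integral>\<^sup>+u. (\<integral>\<^sup>+y. h u (infdist (u powr (- 1 / p) *\<^sub>R y) K) * indicator (- K) (u powr (- 1 / p) *\<^sub>R y) \<partial>lborel)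
       * indicator {0<..} u \<partial>lborel)
    = (\<integral>\<^sup>+x. \<integral>\<^sup>+s. h (power_sum p c x) (s * norm (power_normal p c x) * power_sum p c x powr (- 1 / p)) *
        ennreal (p * (\<Sum>i\<in>UNIV. (power_grad p (c i) (x $ i))\<^sup>2 * (\<Prod>r\<in>UNIV - {i}. 1 + s * power_hess p (c r) (x $ r))))
        * indicator {0<..} s \<partial>lborel \<partial>lborel)"
proof -
  have [measurable]: "(\<lambda>z. infdist z K) \<in> borel_measurable borel"
    by (intro borel_measurable_continuous_onI continuous_intros)
  have "K = {z \<in> space borel. power_sum p c z \<le> 1}" by (simp add: K_def)
  then have [measurable]: "K \<in> sets borel" by simp
  define G where "G = (\<lambda>s x. h (power_sum p c x) (s * norm (power_normal p c x) * power_sum p c x powr (- 1 / p)))"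
  have [measurable]: "case_prod G \<in> borel_measurable (borel \<Otimes>\<^sub>M borel)" unfolding G_def by measurable
  define B where "B = (\<lambda>s x. p * (\<Sum>i\<in>UNIV. (power_grad p (c i) (x $ i))\<^sup>2 * (\<Prod>r\<in>UNIV - {i}. 1 + s * power_hess p (c r) (x $ r))))"
  have [measurable]: "case_prod B \<in> borel_measurable (borel \<Otimes>\<^sub>M borel)" unfolding B_def by measurable
  let ?X = "vec_resolvent p c"
  have "(\<integral>\<^sup>+u. (\<integral>\<^sup>+y. h u (infdist (u powr (- 1 / p) *\<^sub>R y) K) * indicator (- K) (u powr (- 1 / p) *\<^sub>R y) \<partial>lborel)
       * indicator {0<..} u \<partial>lborel)
     = (\<integral>\<^sup>+u. \<integral>\<^sup>+y. h u (infdist (u powr (- 1 / p) *\<^sub>R y) K) * indicator (- K) (u powr (- 1 / p) *\<^sub>R y)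
       * indicator {0<..} u \<partial>lborel \<partial>lborel)"
    by (intro nn_integral_cong nn_integral_multc[symmetric]) simp
  also have "\<dots> = (\<integral>\<^sup>+y. \<integral>\<^sup>+u. h u (infdist (u powr (- 1 / p) *\<^sub>R y) K) * indicator (- K) (u powr (- 1 / p) *\<^sub>R y)
       * indicator {0<..} u \<partial>lborel \<partial>lborel)"
    by (rule lborel_pair.Fubini') simp
  also have "\<dots> = (\<integral>\<^sup>+y. \<integral>\<^sup>+s. ennreal (speed p c s (?X s y)) * G s (?X s y) * indicator {0<..} s \<partial>lborel \<partial>lborel)"
  proof (rule nn_integral_cong_AE)
    show "AE y in lborel. (\<integral>\<^sup>+u. h u (infdist (u powr (- 1 / p) *\<^sub>R y) K) * indicator (- K) (u powr (- 1 / p) *\<^sub>R y)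
       * indicator {0<..} u \<partial>lborel) = (\<integral>\<^sup>+s. ennreal (speed p c s (?X s y)) * G s (?X s y) * indicator {0<..} s \<partial>lborel)"
      using AE_lborel_vec_nonzero
    proof eventually_elim
      case (elim y)
      then show ?case unfolding K_def G_def by (intro nn_integral_radial_substitution) auto
    qed
  qed
  also have "\<dots> = (\<integral>\<^sup>+s. \<integral>\<^sup>+y. ennreal (speed p c s (?X s y)) * G s (?X s y) * indicator {0<..} s \<partial>lborel \<partial>lborel)"
    by (rule lborel_pair.Fubini') simp
  also have "\<dots> = (\<integral>\<^sup>+s. \<integral>\<^sup>+x. G s x * ennreal (B s x) * indicator {0<..} s \<partial>lborel \<partial>lborel)"
  proof (rule nn_integral_cong)
    fix s :: real
    show "(\<integral>\<^sup>+y. ennreal (speed p c s (?X s y)) * G s (?X s y) * indicator {0<..} s \<partial>lborel) =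
        (\<integral>\<^sup>+x. G s x * ennreal (B s x) * indicator {0<..} s \<partial>lborel)"
    proof (cases "0 < s")
      case True
      then have s: "0 \<le> s" by simp
      \<comment> \<open>Substituting \<open>y = x + s g(x)\<close> makes the foot point of
        \<open>y\<close> equal to \<open>x\<close>, so the resolvent disappears from the
        integrand.\<close>
      have "(\<integral>\<^sup>+y. ennreal (speed p c s (?X s y)) * G s (?X s y) * indicator {0<..} s \<partial>lborel) =
         (\<integral>\<^sup>+x. (ennreal (speed p c s x) * G s x * indicator {0<..} s) *
           ennreal (\<Prod>r\<in>UNIV. 1 + s * power_hess p (c r) (x $ r)) \<partial>lborel)"
        by (subst nn_integral_normal_map_vec[OF s]) (simp_all add: vec_resolvent_normal_map[OF s])
      also have "\<dots> = (\<integral>\<^sup>+x. G s x * ennreal (B s x) * indicator {0<..} s \<partial>lborel)"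
      proof (intro nn_integral_cong)
        fix x :: "real ^ 'n"
        have "ennreal (B s x) = ennreal (speed p c s x) * ennreal (\<Prod>r\<in>UNIV. 1 + s * power_hess p (c r) (x $ r))"
          unfolding B_def speed_times_jacobian[OF s, symmetric]
          using one_plus_hess_pos[OF s] by (intro ennreal_mult'' prod_nonneg) (simp add: less_imp_le)
        then show "(ennreal (speed p c s x) * G s x * indicator {0<..} s) *
           ennreal (\<Prod>r\<in>UNIV. 1 + s * power_hess p (c r) (x $ r)) = G s x * ennreal (B s x) * indicator {0<..} s"
          by (simp add: mult_ac)
      qed
      finally show ?thesis .
    qed simp
  qed
  also have "\<dots> = (\<integral>\<^sup>+x. \<integral>\<^sup>+s. G s x * ennreal (B s x) * indicator {0<..} s \<partial>lborel \<partial>lborel)"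
    by (rule lborel_pair.Fubini') simp
  finally show ?thesis unfolding G_def B_def .
qed

end

section \<open>The volume of the outer parallel body\<close>

text \<open>The coefficient of \<open>s ^ k\<close> in the integrand. At points with all coordinates
  nonzero, division by \<open>\<bar>g\<bar> ^ (k + 2)\<close> gives the k-th elementary symmetric
  function of the principal curvatures of the level surface.\<close>

definition normal_sum :: "real \<Rightarrow> ('n::finite \<Rightarrow> real) \<Rightarrow> nat \<Rightarrow> real ^ 'n \<Rightarrow> real" where
  "normal_sum p c k x = (\<Sum>i\<in>UNIV. \<Sum>I\<in>{I. I \<subseteq> UNIV - {i} \<and> card I = k}.
     (power_grad p (c i) (x $ i))\<^sup>2 * (\<Prod>r\<in>I. power_hess p (c r) (x $ r)))"

lemma borel_measurable_normal_sum [measurable]: "normal_sum p c k \<in> borel_measurable borel"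
  unfolding normal_sum_def by measurable

text \<open>The subsets that arise from expanding the product are grouped by cardinality, which
  stays below n because \<open>i\<close> is missing.\<close>

lemma prod_one_plus_expand:
  fixes d :: "'n::finite \<Rightarrow> real"
  shows "(\<Prod>r\<in>UNIV - {i}. 1 + s * d r) =
    (\<Sum>k<CARD('n). s ^ k * (\<Sum>I\<in>{I. I \<subseteq> UNIV - {i} \<and> card I = k}. \<Prod>r\<in>I. d r))"
proof -
  have "(\<Prod>r\<in>UNIV - {i}. 1 + s * d r) = (\<Prod>r\<in>UNIV - {i}. s * d r + 1)" by (simp add: add.commute)
  also have "\<dots> = (\<Sum>I\<in>Pow (UNIV - {i}). (\<Prod>r\<in>I. s * d r) * (\<Prod>r\<in>UNIV - {i} - I. 1))"
    by (rule prod_add) simp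
  also have "\<dots> = (\<Sum>I\<in>Pow (UNIV - {i}). s ^ card I * (\<Prod>r\<in>I. d r))"
    by (simp add: prod.distrib)
  also have "\<dots> = (\<Sum>k<CARD('n). \<Sum>I\<in>{I \<in> Pow (UNIV - {i}). card I = k}. s ^ card I * (\<Prod>r\<in>I. d r))"
  proof (rule sum.group[symmetric])
    show "card ` Pow (UNIV - {i}) \<subseteq> {..<CARD('n)}"
    proof safe
      fix I assume "I \<subseteq> UNIV - {i}"
      then have "I \<subset> UNIV" by auto
      then show "card I < CARD('n)" by (rule psubset_card_mono[rotated]) simp
    qed
  qed auto
  also have "\<dots> = (\<Sum>k<CARD('n). s ^ k * (\<Sum>I\<in>{I. I \<subseteq> UNIV - {i} \<and> card I = k}. \<Prod>r\<in>I. d r))"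
    by (intro sum.cong refl, subst sum_distrib_left) (intro sum.cong, auto)
  finally show ?thesis .
qed

lemma normal_sum_expand:
  fixes c :: "'n::finite \<Rightarrow> real"
  shows "(\<Sum>i\<in>UNIV. (power_grad p (c i) (x $ i))\<^sup>2 * (\<Prod>r\<in>UNIV - {i}. 1 + s * power_hess p (c r) (x $ r)))
    = (\<Sum>k<CARD('n). s ^ k * normal_sum p c k x)"
  unfolding prod_one_plus_expand normal_sum_def sum_distrib_left
  by (subst sum.swap) (simp add: mult_ac sum_distrib_left)

section \<open>Dilations and elementary one-variable integrals\<close>

lemma nn_integral_lborel_scaleR:
  fixes f :: "'a::euclidean_space \<Rightarrow> ennreal"
  assumes [measurable]: "f \<in> borel_measurable borel" and b: "b > 0"
  shows "(\<integral>\<^sup>+x. f (b *\<^sub>R x) \<partial>lborel) = ennreal ((1 / b) ^ DIM('a)) * (\<integral>\<^sup>+x. f x \<partial>lborel)"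
proof -
  have "(\<integral>\<^sup>+x. f (b *\<^sub>R x) \<partial>lborel) =
     (\<integral>\<^sup>+x. f (b *\<^sub>R x) \<partial>density (distr lborel borel (\<lambda>x. 0 + (1 / b) *\<^sub>R x)) (\<lambda>_. ennreal (\<bar>1 / b\<bar> ^ DIM('a))))"
    using lborel_affine[of "1 / b" "0 :: 'a"] b by simp
  also have "\<dots> = ennreal ((1 / b) ^ DIM('a)) * (\<integral>\<^sup>+x. f x \<partial>lborel)"
    using b by (simp add: nn_integral_density nn_integral_distr nn_integral_cmult)
  finally show ?thesis .
qed

lemma nn_integral_exp_powr:
  assumes "z > -1"
  shows "(\<integral>\<^sup>+u. ennreal (exp (- u) * u powr z) * indicator {0<..} u \<partial>lborel) = ennreal (Gamma (1 + z))"
proof -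
  have "(\<integral>\<^sup>+u. ennreal (exp (- u) * u powr z) * indicator {0<..} u \<partial>lborel) =
     (\<integral>\<^sup>+u. ennreal (indicator {0..} u * u powr (1 + z - 1) / exp u) \<partial>lborel)"
  proof (rule nn_integral_cong_AE)
    show "AE u in lborel. ennreal (exp (- u) * u powr z) * indicator {0<..} u =
        ennreal (indicator {0..} u * u powr (1 + z - 1) / exp u)"
      using AE_lborel_singleton[of 0] by eventually_elim (auto simp: indicator_def exp_minus field_simps)
  qed
  also have "\<dots> = ennreal (Gamma (1 + z))"
    using assms by (intro Gamma_conv_nn_integral_real[symmetric]) simp
  finally show ?thesis .
qed

lemma nn_integral_power_sum_Ioc:
  fixes q :: "nat \<Rightarrow> real"
  assumes q: "\<And>k. 0 \<le> q k" and T: "0 \<le> T"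
  shows "(\<integral>\<^sup>+s. ennreal (\<Sum>k<N. s ^ k * q k) * indicator {0<..T} s \<partial>lborel) = ennreal (\<Sum>k<N. T ^ Suc k * q k / real (Suc k))"
proof -
  have "(\<integral>\<^sup>+s. ennreal (\<Sum>k<N. s ^ k * q k) * indicator {0<..T} s \<partial>lborel) =
     (\<integral>\<^sup>+s. ennreal (\<Sum>k<N. s ^ k * q k) * indicator {0..T} s \<partial>lborel)"
  proof (rule nn_integral_cong_AE)
    show "AE s in lborel. ennreal (\<Sum>k<N. s ^ k * q k) * indicator {0<..T} s = ennreal (\<Sum>k<N. s ^ k * q k) * indicator {0..T} s"
      using AE_lborel_singleton[of 0] by eventually_elim (auto simp: indicator_def)
  qed
  also have "\<dots> = ennreal ((\<Sum>k<N. T ^ Suc k * q k / real (Suc k)) - (\<Sum>k<N. 0 ^ Suc k * q k / real (Suc k)))"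
  proof (rule nn_integral_FTC_Icc)
    fix s :: real assume s: "s \<in> {0..T}"
    have "((\<lambda>s. s ^ Suc k * q k / real (Suc k)) has_real_derivative s ^ k * q k) (at s)" for k
      by (rule derivative_eq_intros | simp)+
    then show "((\<lambda>s. \<Sum>k<N. s ^ Suc k * q k / real (Suc k)) has_real_derivative (\<Sum>k<N. s ^ k * q k)) (at s)"
      by (rule DERIV_sum)
    show "0 \<le> (\<Sum>k<N. s ^ k * q k)" using s q by (intro sum_nonneg mult_nonneg_nonneg) auto
  qed (use T in auto)
  finally show ?thesis by simp
qed

text \<open>The body itself is removed, so the resulting polynomial in \<open>t\<close> has no
  constant term.\<close>

definition outer_volume :: "real \<Rightarrow> ('n::finite \<Rightarrow> real) \<Rightarrow> real \<Rightarrow> ennreal" where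
  "outer_volume p c t = emeasure lborel ({z. infdist (z :: real ^ 'n) {z. power_sum p c z \<le> 1} \<le> t} - {z. power_sum p c z \<le> 1})"

text \<open>The exponent \<open>e = 0\<close> belongs to parallel bodies at distance \<open>t u powr (1 / p)\<close> of \<open>{F \<le> u}\<close>, and
  \<open>e = - 1 / p\<close> to those at distance \<open>t\<close>.\<close>

definition outer_coeff :: "real \<Rightarrow> ('n::finite \<Rightarrow> real) \<Rightarrow> real \<Rightarrow> nat \<Rightarrow> ennreal" where
  "outer_coeff p c e k = (\<integral>\<^sup>+(x :: real ^ 'n). ennreal (exp (- power_sum p c x) *
     ((power_sum p c x powr (e + 1 / p) / norm (power_normal p c x)) ^ Suc k * (p * normal_sum p c k x) / real (Suc k))) \<partial>lborel)"

text \<open>The coefficient of \<open>t ^ (k + 1)\<close> in the outer volume. The Gamma value is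
  the integral of \<open>exp (- u) * u powr (n / p)\<close>, where \<open>u powr (n / p)\<close>
  comes from dilating by \<open>u powr (1 / p)\<close>.\<close>

definition steiner_coeff :: "real \<Rightarrow> ('n::finite \<Rightarrow> real) \<Rightarrow> nat \<Rightarrow> real" where
  "steiner_coeff p c k = enn2real (outer_coeff p c 0 k) / Gamma (1 + real CARD('n) / p)"

context
  fixes p :: real and c :: "'n::finite \<Rightarrow> real"
  assumes p: "1 < p" and c: "\<And>r. 0 < c r"
begin

lemma normal_sum_nonneg: "0 \<le> normal_sum p c k x"
  unfolding normal_sum_def
  by (intro sum_nonneg mult_nonneg_nonneg prod_nonneg power_hess_nonneg p c) simp_all

lemma compact_sublevel: "compact {z. power_sum p c z \<le> 1}"
proof (rule compact_eq_bounded_closed[THEN iffD2], rule conjI)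
  show "closed {z. power_sum p c z \<le> 1}"
    using continuous_on_power_sum[OF p c, of UNIV] by (intro closed_Collect_le) simp_all
  show "bounded {z. power_sum p c z \<le> 1}"
  proof (rule boundedI)
    fix z assume "z \<in> {z. power_sum p c z \<le> 1}"
    then have z: "power_sum p c z \<le> 1" by simp
    have "\<bar>z $ r\<bar> \<le> (1 / c r) powr (1 / p)" for r
    proof -
      have "c r * \<bar>z $ r\<bar> powr p \<le> power_sum p c z"
        unfolding power_sum_def using c by (intro member_le_sum) (simp_all add: less_imp_le)
      then have "c r * \<bar>z $ r\<bar> powr p \<le> 1" using z by linarith
      then have "\<bar>z $ r\<bar> powr p \<le> 1 / c r" using c[of r] by (simp add: pos_le_divide_eq mult.commute)
      then have "(\<bar>z $ r\<bar> powr p) powr (1 / p) \<le> (1 / c r) powr (1 / p)"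
        using p by (intro powr_mono2) auto
      then show ?thesis using p by (simp add: powr_powr)
    qed
    then have "(\<Sum>r\<in>UNIV. \<bar>z $ r\<bar>) \<le> (\<Sum>r\<in>UNIV. (1 / c r) powr (1 / p))" by (rule sum_mono)
    then show "norm z \<le> (\<Sum>r\<in>UNIV. (1 / c r) powr (1 / p))" using norm_le_l1_cart[of z] by linarith
  qed
qed

text \<open>\<open>parallel_body_master\<close> for the weight \<open>exp (- u)\<close> and the
  bound \<open>t * u powr e\<close> on the rescaled distance. On the right, the inner integral of a
  polynomial in \<open>s\<close> runs over a bounded interval and is elementary.\<close>

lemma outer_volume_transform:
  assumes t: "0 \<le> t"
  shows "(\<integral>\<^sup>+u. ennreal (exp (- u) * u powr (real CARD('n) / p)) * outer_volume p c (t * u powr e) * indicator {0<..} u \<partial>lborel)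
    = (\<Sum>k<CARD('n). ennreal (t ^ Suc k) * outer_coeff p c e k)"
proof -
  define K where "K = {z. power_sum p c z \<le> 1}"
  define A where "A t = {z. infdist z K \<le> t} - K" for t
  have K [measurable]: "K \<in> sets borel"
    using compact_sublevel by (auto simp: K_def intro: borel_compact)
  have [measurable]: "(\<lambda>z. infdist z K) \<in> borel_measurable borel"
    by (intro borel_measurable_continuous_onI continuous_intros)
  have "A t = {z \<in> space borel. infdist z K \<le> t} - K" for t by (simp add: A_def)
  then have [measurable]: "A t \<in> sets borel" for t by simp
  define h where "h = (\<lambda>u \<delta>. ennreal (exp (- u)) * indicator {w. snd w \<le> t * fst w powr e} (u, \<delta> :: real))"
  have [measurable]: "case_prod h \<in> borel_measurable (borel \<Otimes>\<^sub>M borel)"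
  proof -
    have "{w. snd w \<le> t * fst w powr e} = {w \<in> space (borel \<Otimes>\<^sub>M borel). snd w \<le> t * fst w powr e}"
      by (simp add: space_pair_measure)
    also have "\<dots> \<in> sets (borel \<Otimes>\<^sub>M borel)" by measurable
    finally have [measurable]: "{w. snd w \<le> t * fst w powr e} \<in> sets (borel \<Otimes>\<^sub>M borel)" .
    show ?thesis unfolding h_def by measurable
  qed
  have "(\<integral>\<^sup>+u. ennreal (exp (- u) * u powr (real CARD('n) / p)) * outer_volume p c (t * u powr e) * indicator {0<..} u \<partial>lborel)
     = (\<integral>\<^sup>+u. (\<integral>\<^sup>+y. h u (infdist (u powr (- 1 / p) *\<^sub>R y) K) * indicator (- K) (u powr (- 1 / p) *\<^sub>R y) \<partial>lborel)
       * indicator {0<..} u \<partial>lborel)"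
  proof (rule nn_integral_cong)
    fix u :: real
    show "ennreal (exp (- u) * u powr (real CARD('n) / p)) * outer_volume p c (t * u powr e) * indicator {0<..} u =
      (\<integral>\<^sup>+y. h u (infdist (u powr (- 1 / p) *\<^sub>R y) K) * indicator (- K) (u powr (- 1 / p) *\<^sub>R y) \<partial>lborel) * indicator {0<..} u"
    proof (cases "0 < u")
      case True
      have "(\<integral>\<^sup>+y. h u (infdist (u powr (- 1 / p) *\<^sub>R y) K) * indicator (- K) (u powr (- 1 / p) *\<^sub>R y) \<partial>lborel)
        = (\<integral>\<^sup>+y. ennreal (exp (- u)) * indicator (A (t * u powr e)) (u powr (- 1 / p) *\<^sub>R y) \<partial>lborel)"
        by (intro nn_integral_cong) (auto simp: h_def A_def indicator_def)
      also have "\<dots> = ennreal (exp (- u)) * (ennreal ((1 / u powr (- 1 / p)) ^ DIM(real ^ 'n)) * emeasure lborel (A (t * u powr e)))"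
        using True by (subst nn_integral_cmult, simp, subst nn_integral_lborel_scaleR) simp_all
      \<comment> \<open>The Jacobian of the dilation that identifies the points \<open>y\<close>
        with the fixed rescaled shell.\<close>
      also have "(1 / u powr (- 1 / p)) ^ DIM(real ^ 'n) = u powr (real CARD('n) / p)"
      proof -
        have "1 / u powr (- 1 / p) = u powr (1 / p)" by (simp add: powr_minus_divide)
        moreover have "(u powr (1 / p)) ^ CARD('n) = u powr (1 / p * real CARD('n))"
          using True by (simp add: powr_realpow[symmetric] powr_powr)
        ultimately show ?thesis by simp
      qed
      finally show ?thesis
        using True by (simp add: outer_volume_def A_def K_def ennreal_mult mult_ac)
    qed simp
  qed
  also have "\<dots> = (\<integral>\<^sup>+x. \<integral>\<^sup>+s. h (power_sum p c x) (s * norm (power_normal p c x) * power_sum p c x powr (- 1 / p)) *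
        ennreal (p * (\<Sum>i\<in>UNIV. (power_grad p (c i) (x $ i))\<^sup>2 * (\<Prod>r\<in>UNIV - {i}. 1 + s * power_hess p (c r) (x $ r))))
        * indicator {0<..} s \<partial>lborel \<partial>lborel)"
    unfolding K_def by (rule parallel_body_master[OF p c]) simp_all
  also have "\<dots> = (\<integral>\<^sup>+x. (\<Sum>k<CARD('n). ennreal (t ^ Suc k) * ennreal (exp (- power_sum p c x) *
     ((power_sum p c x powr (e + 1 / p) / norm (power_normal p c x)) ^ Suc k * (p * normal_sum p c k x) / real (Suc k)))) \<partial>lborel)"
  proof (rule nn_integral_cong_AE)
    show "AE x in lborel. (\<integral>\<^sup>+s. h (power_sum p c x) (s * norm (power_normal p c x) * power_sum p c x powr (- 1 / p)) *
        ennreal (p * (\<Sum>i\<in>UNIV. (power_grad p (c i) (x $ i))\<^sup>2 * (\<Prod>r\<in>UNIV - {i}. 1 + s * power_hess p (c r) (x $ r))))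
        * indicator {0<..} s \<partial>lborel) = (\<Sum>k<CARD('n). ennreal (t ^ Suc k) * ennreal (exp (- power_sum p c x) *
     ((power_sum p c x powr (e + 1 / p) / norm (power_normal p c x)) ^ Suc k * (p * normal_sum p c k x) / real (Suc k))))"
      using AE_lborel_vec_nonzero
    proof eventually_elim
      case (elim x)
      then have "x \<noteq> 0" by auto
      then have F: "power_sum p c x > 0" by (rule power_sum_pos[OF p c])
      have "power_normal p c x \<noteq> 0"
        using elim power_grad_eq_0_iff[OF p c] by (auto simp: power_normal_def vec_eq_iff)
      then have g: "norm (power_normal p c x) > 0" by simp
      \<comment> \<open>The value of \<open>s\<close> at which the rescaled distance of
        \<open>x + s g(x)\<close> reaches its bound.\<close>
      define T where "T = t * (power_sum p c x powr (e + 1 / p) / norm (power_normal p c x))"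
      have T: "T \<ge> 0" using t by (simp add: T_def)
      have iff: "s * norm (power_normal p c x) * power_sum p c x powr (- 1 / p) \<le> t * power_sum p c x powr e \<longleftrightarrow> s \<le> T" for s
      proof -
        have "power_sum p c x powr e = power_sum p c x powr (e + 1 / p) * power_sum p c x powr (- 1 / p)"
          by (simp add: powr_add[symmetric])
        then have "s * norm (power_normal p c x) * power_sum p c x powr (- 1 / p) \<le> t * power_sum p c x powr e
          \<longleftrightarrow> s * norm (power_normal p c x) * power_sum p c x powr (- 1 / p) \<le> (t * power_sum p c x powr (e + 1 / p)) * power_sum p c x powr (- 1 / p)"
          by (simp add: mult.assoc)
        also have "\<dots> \<longleftrightarrow> s * norm (power_normal p c x) \<le> t * power_sum p c x powr (e + 1 / p)"
          using F by (subst mult_le_cancel_right_pos) auto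
        also have "\<dots> \<longleftrightarrow> s \<le> T" using g by (simp add: T_def pos_le_divide_eq)
        finally show ?thesis .
      qed
      have "(\<integral>\<^sup>+s. h (power_sum p c x) (s * norm (power_normal p c x) * power_sum p c x powr (- 1 / p)) *
        ennreal (p * (\<Sum>i\<in>UNIV. (power_grad p (c i) (x $ i))\<^sup>2 * (\<Prod>r\<in>UNIV - {i}. 1 + s * power_hess p (c r) (x $ r))))
        * indicator {0<..} s \<partial>lborel) =
        (\<integral>\<^sup>+s. ennreal (exp (- power_sum p c x)) * (ennreal (\<Sum>k<CARD('n). s ^ k * (p * normal_sum p c k x)) * indicator {0<..T} s) \<partial>lborel)"
      proof (rule nn_integral_cong)
        fix s :: real
        have "(indicator {w. snd w \<le> t * fst w powr e} (power_sum p c x, s * norm (power_normal p c x) * power_sum p c x powr (- 1 / p)) :: ennreal)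
          = indicator {..T} s" using iff[of s] by (simp add: indicator_def)
        moreover have "indicator {0<..T} s = indicator {..T} s * (indicator {0<..} s :: ennreal)"
          by (auto simp: indicator_def)
        moreover have "p * (\<Sum>i\<in>UNIV. (power_grad p (c i) (x $ i))\<^sup>2 * (\<Prod>r\<in>UNIV - {i}. 1 + s * power_hess p (c r) (x $ r)))
          = (\<Sum>k<CARD('n). s ^ k * (p * normal_sum p c k x))"
          unfolding normal_sum_expand by (simp add: sum_distrib_left mult_ac)
        ultimately show "h (power_sum p c x) (s * norm (power_normal p c x) * power_sum p c x powr (- 1 / p)) *
          ennreal (p * (\<Sum>i\<in>UNIV. (power_grad p (c i) (x $ i))\<^sup>2 * (\<Prod>r\<in>UNIV - {i}. 1 + s * power_hess p (c r) (x $ r))))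
          * indicator {0<..} s = ennreal (exp (- power_sum p c x)) * (ennreal (\<Sum>k<CARD('n). s ^ k * (p * normal_sum p c k x)) * indicator {0<..T} s)"
          unfolding h_def by (simp only: mult_ac)
      qed
      also have "\<dots> = ennreal (exp (- power_sum p c x)) * ennreal (\<Sum>k<CARD('n). T ^ Suc k * (p * normal_sum p c k x) / real (Suc k))"
        using p normal_sum_nonneg T
        by (subst nn_integral_cmult, simp, subst nn_integral_power_sum_Ioc) simp_all
      also have "\<dots> = (\<Sum>k<CARD('n). ennreal (exp (- power_sum p c x)) * ennreal (T ^ Suc k * (p * normal_sum p c k x) / real (Suc k)))"
        using p normal_sum_nonneg T
        by (subst sum_ennreal[symmetric]) (simp_all add: sum_distrib_left del: sum_ennreal)
      also have "\<dots> = (\<Sum>k<CARD('n). ennreal (t ^ Suc k) * ennreal (exp (- power_sum p c x) *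
         ((power_sum p c x powr (e + 1 / p) / norm (power_normal p c x)) ^ Suc k * (p * normal_sum p c k x) / real (Suc k))))"
      proof (rule sum.cong[OF refl])
        fix k
        have "exp (- power_sum p c x) * (T ^ Suc k * (p * normal_sum p c k x) / real (Suc k)) =
          t ^ Suc k * (exp (- power_sum p c x) *
         ((power_sum p c x powr (e + 1 / p) / norm (power_normal p c x)) ^ Suc k * (p * normal_sum p c k x) / real (Suc k)))"
          unfolding T_def power_mult_distrib by (simp only: mult_ac times_divide_eq_right)
        then show "ennreal (exp (- power_sum p c x)) * ennreal (T ^ Suc k * (p * normal_sum p c k x) / real (Suc k)) =
         ennreal (t ^ Suc k) * ennreal (exp (- power_sum p c x) *
         ((power_sum p c x powr (e + 1 / p) / norm (power_normal p c x)) ^ Suc k * (p * normal_sum p c k x) / real (Suc k)))"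
          using t by (simp only: ennreal_mult'[symmetric] exp_ge_zero zero_le_power)
      qed
      finally show ?case .
    qed
  qed
  also have "\<dots> = (\<Sum>k<CARD('n). ennreal (t ^ Suc k) * outer_coeff p c e k)"
    unfolding outer_coeff_def by (subst nn_integral_sum) (simp_all add: nn_integral_cmult)
  finally show ?thesis .
qed

lemma outer_volume_finite:
  assumes "0 \<le> t"
  shows "outer_volume p c t < \<infinity>"
proof -
  let ?K = "{z. power_sum p c z \<le> 1}"
  have "power_sum p c 0 = 0" using p by (simp add: power_sum_def)
  then have ne: "?K \<noteq> {}" by (auto intro: exI[of _ 0])
  have "bounded {z. infdist z ?K \<le> t + 1}"
    using compact_infdist_le[OF ne compact_sublevel, of "t + 1"] assms by (simp add: compact_imp_bounded)
  then have "bounded ({z. infdist z ?K \<le> t} - ?K)"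
    by (rule bounded_subset) auto
  then show ?thesis unfolding outer_volume_def by (rule emeasure_bounded_finite)
qed

text \<open>At \<open>t = 1\<close> the nonnegative coefficients add up to a Gamma value times the
  volume of a bounded shell.\<close>

lemma outer_coeff_0_finite:
  assumes "k < CARD('n)"
  shows "outer_coeff p c 0 k < \<infinity>"
proof -
  have "(\<Sum>k<CARD('n). ennreal (1 ^ Suc k) * outer_coeff p c 0 k) =
    (\<integral>\<^sup>+u. ennreal (exp (- u) * u powr (real CARD('n) / p)) * outer_volume p c (1 * u powr 0) * indicator {0<..} u \<partial>lborel)"
    by (rule outer_volume_transform[symmetric]) simp
  also have "\<dots> = (\<integral>\<^sup>+u. outer_volume p c 1 * (ennreal (exp (- u) * u powr (real CARD('n) / p)) * indicator {0<..} u) \<partial>lborel)"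
    by (intro nn_integral_cong) (simp add: mult_ac indicator_def)
  also have "\<dots> = outer_volume p c 1 * ennreal (Gamma (1 + real CARD('n) / p))"
  proof -
    have "-1 < real CARD('n) / p" by (rule order_less_le_trans[of "-1" 0]) (use p in auto)
    then show ?thesis by (subst nn_integral_cmult) (simp_all add: nn_integral_exp_powr)
  qed
  also have "\<dots> < \<infinity>"
    using outer_volume_finite[of 1] by (simp add: ennreal_mult_less_top)
  finally have "(\<Sum>k<CARD('n). outer_coeff p c 0 k) < \<infinity>" by simp
  then show ?thesis using assms by simp
qed

lemma steiner_coeff_nonneg: "0 \<le> steiner_coeff p c k"
proof -
  have "0 < 1 + real CARD('n) / p" using p by (intro add_pos_nonneg) auto
  then show ?thesis unfolding steiner_coeff_def by (intro divide_nonneg_pos Gamma_real_pos) simp_all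
qed

text \<open>For \<open>e = 0\<close> the shell does not depend on \<open>u\<close>, so its volume
  leaves the integral with a positive Gamma factor, which is then cancelled.\<close>

lemma outer_volume_eq:
  assumes t: "0 \<le> t"
  shows "outer_volume p c t = ennreal (\<Sum>k<CARD('n). t ^ Suc k * steiner_coeff p c k)"
proof -
  let ?G = "Gamma (1 + real CARD('n) / p)"
  have z: "-1 < real CARD('n) / p" by (rule order_less_le_trans[of "-1" 0]) (use p in auto)
  then have G: "?G > 0" by (intro Gamma_real_pos) linarith
  have "outer_volume p c t * ennreal ?G =
      (\<integral>\<^sup>+u. outer_volume p c t * (ennreal (exp (- u) * u powr (real CARD('n) / p)) * indicator {0<..} u) \<partial>lborel)"
    using z by (subst nn_integral_cmult) (simp_all add: nn_integral_exp_powr)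
  also have "\<dots> = (\<integral>\<^sup>+u. ennreal (exp (- u) * u powr (real CARD('n) / p)) * outer_volume p c (t * u powr 0) * indicator {0<..} u \<partial>lborel)"
    by (intro nn_integral_cong) (simp add: mult_ac indicator_def)
  also have "\<dots> = (\<Sum>k<CARD('n). ennreal (t ^ Suc k) * outer_coeff p c 0 k)"
    by (rule outer_volume_transform[OF t])
  also have "\<dots> = (\<Sum>k<CARD('n). ennreal (t ^ Suc k * steiner_coeff p c k * ?G))"
  proof (rule sum.cong[OF refl])
    fix k assume "k \<in> {..<CARD('n)}"
    then have "outer_coeff p c 0 k = ennreal (enn2real (outer_coeff p c 0 k))"
      using outer_coeff_0_finite[of k] by simp
    also have "\<dots> = ennreal (steiner_coeff p c k * ?G)" using G by (simp add: steiner_coeff_def)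
    finally show "ennreal (t ^ Suc k) * outer_coeff p c 0 k = ennreal (t ^ Suc k * steiner_coeff p c k * ?G)"
      using t by (simp add: ennreal_mult'[symmetric] mult.assoc)
  qed
  also have "\<dots> = ennreal ((\<Sum>k<CARD('n). t ^ Suc k * steiner_coeff p c k) * ?G)"
    unfolding sum_distrib_right using t G steiner_coeff_nonneg by (intro sum_ennreal) simp
  finally have eq: "outer_volume p c t * ennreal ?G = ennreal ((\<Sum>k<CARD('n). t ^ Suc k * steiner_coeff p c k) * ?G)" .
  obtain v where v: "outer_volume p c t = ennreal v" "0 \<le> v"
    using outer_volume_finite[OF t] by (cases "outer_volume p c t") auto
  have "0 \<le> (\<Sum>k<CARD('n). t ^ Suc k * steiner_coeff p c k)"
    using t steiner_coeff_nonneg by (intro sum_nonneg) simp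
  then have "v * ?G = (\<Sum>k<CARD('n). t ^ Suc k * steiner_coeff p c k) * ?G"
    using eq v G unfolding v(1) by (simp add: ennreal_mult[symmetric] ennreal_inj)
  then show ?thesis using G v by simp
qed

text \<open>The shell volume is now a known polynomial. Inserting
  \<open>t * u powr (- 1 / p)\<close> and integrating over \<open>u\<close> gives each power of
  \<open>t\<close> its own Gamma factor, to be compared with \<open>outer_volume_transform\<close>
  for \<open>e = - 1 / p\<close>.\<close>

lemma outer_coeff_eq:
  assumes k: "k < CARD('n)"
  shows "outer_coeff p c (- 1 / p) k = ennreal (steiner_coeff p c k * Gamma (1 + real (CARD('n) - Suc k) / p))"
proof -
  define b where "b k = steiner_coeff p c k * Gamma (1 + real (CARD('n) - Suc k) / p)" for k
  have z: "-1 < real (CARD('n) - Suc k) / p" for k by (rule order_less_le_trans[of "-1" 0]) (use p in auto)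
  have G: "Gamma (1 + real (CARD('n) - Suc k) / p) > 0" for k using z[of k] by (intro Gamma_real_pos) linarith
  have b: "0 \<le> b k" for k unfolding b_def using G[of k] steiner_coeff_nonneg[of k] by simp
  have eq: "(\<Sum>k<CARD('n). ennreal (t ^ Suc k) * outer_coeff p c (- 1 / p) k) = ennreal (\<Sum>k<CARD('n). t ^ Suc k * b k)"
    if t: "0 \<le> t" for t
  proof -
    have "(\<Sum>k<CARD('n). ennreal (t ^ Suc k) * outer_coeff p c (- 1 / p) k) =
      (\<integral>\<^sup>+u. ennreal (exp (- u) * u powr (real CARD('n) / p)) * outer_volume p c (t * u powr (- 1 / p)) * indicator {0<..} u \<partial>lborel)"
      by (rule outer_volume_transform[symmetric, OF t])
    also have "\<dots> = (\<integral>\<^sup>+u. (\<Sum>k<CARD('n). ennreal (t ^ Suc k * steiner_coeff p c k) *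
        (ennreal (exp (- u) * u powr (real (CARD('n) - Suc k) / p)) * indicator {0<..} u)) \<partial>lborel)"
    proof (rule nn_integral_cong)
      fix u :: real
      show "ennreal (exp (- u) * u powr (real CARD('n) / p)) * outer_volume p c (t * u powr (- 1 / p)) * indicator {0<..} u =
        (\<Sum>k<CARD('n). ennreal (t ^ Suc k * steiner_coeff p c k) *
        (ennreal (exp (- u) * u powr (real (CARD('n) - Suc k) / p)) * indicator {0<..} u))"
      proof (cases "0 < u")
        case True
        have "exp (- u) * u powr (real CARD('n) / p) * (\<Sum>k<CARD('n). (t * u powr (- 1 / p)) ^ Suc k * steiner_coeff p c k)
           = (\<Sum>k<CARD('n). (t ^ Suc k * steiner_coeff p c k) * (exp (- u) * u powr (real (CARD('n) - Suc k) / p)))"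
          unfolding sum_distrib_left
        proof (rule sum.cong[OF refl])
          fix k assume "k \<in> {..<CARD('n)}"
          \<comment> \<open>Since \<open>k < n\<close>, the truncated difference on the right is the
            true one.\<close>
          then have "real CARD('n) / p + (- 1 / p) * real (Suc k) = real (CARD('n) - Suc k) / p"
            by (simp add: of_nat_diff diff_divide_distrib add_divide_distrib)
          then have "u powr (real CARD('n) / p) * (u powr (- 1 / p)) ^ Suc k = u powr (real (CARD('n) - Suc k) / p)"
            using True by (subst powr_realpow[symmetric]) (simp_all only: powr_powr powr_add[symmetric] powr_gt_zero)
          then show "exp (- u) * u powr (real CARD('n) / p) * ((t * u powr (- 1 / p)) ^ Suc k * steiner_coeff p c k) =
            (t ^ Suc k * steiner_coeff p c k) * (exp (- u) * u powr (real (CARD('n) - Suc k) / p))"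
            unfolding power_mult_distrib by (simp only: mult_ac)
        qed
        then have "ennreal (exp (- u) * u powr (real CARD('n) / p)) * outer_volume p c (t * u powr (- 1 / p)) =
          ennreal (\<Sum>k<CARD('n). (t ^ Suc k * steiner_coeff p c k) * (exp (- u) * u powr (real (CARD('n) - Suc k) / p)))"
          using t by (subst outer_volume_eq) (simp_all add: ennreal_mult'[symmetric])
        also have "\<dots> = (\<Sum>k<CARD('n). ennreal (t ^ Suc k * steiner_coeff p c k) * ennreal (exp (- u) * u powr (real (CARD('n) - Suc k) / p)))"
          using t steiner_coeff_nonneg by (subst sum_ennreal[symmetric]) (simp_all add: ennreal_mult del: sum_ennreal)
        finally show ?thesis using True by simp
      qed simp
    qed
    also have "\<dots> = (\<Sum>k<CARD('n). ennreal (t ^ Suc k * steiner_coeff p c k) * ennreal (Gamma (1 + real (CARD('n) - Suc k) / p)))"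
      using z by (subst nn_integral_sum) (simp_all add: nn_integral_cmult nn_integral_exp_powr del: of_nat_diff)
    also have "\<dots> = (\<Sum>k<CARD('n). ennreal (t ^ Suc k * b k))"
      using G by (simp add: b_def ennreal_mult''[symmetric] less_imp_le mult.assoc del: of_nat_diff)
    also have "\<dots> = ennreal (\<Sum>k<CARD('n). t ^ Suc k * b k)"
      using t b by (intro sum_ennreal) simp
    finally show ?thesis .
  qed
  have fin: "outer_coeff p c (- 1 / p) k < \<infinity>" if "k < CARD('n)" for k
  proof -
    have "(\<Sum>k<CARD('n). outer_coeff p c (- 1 / p) k) < \<infinity>" using eq[of 1] by simp
    then show ?thesis using that by simp
  qed
  txt \<open>Both sides of \<open>eq\<close> are polynomials in \<open>t\<close>, so their coefficients agree.\<close>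
  define d where "d k = (if k = 0 then 0 else enn2real (outer_coeff p c (- 1 / p) (k - 1)) - b (k - 1))" for k
  have "(\<Sum>i\<le>CARD('n). d i * t ^ i) = 0" if t: "0 \<le> t" for t
  proof -
    have "ennreal (\<Sum>k<CARD('n). t ^ Suc k * enn2real (outer_coeff p c (- 1 / p) k)) = (\<Sum>k<CARD('n). ennreal (t ^ Suc k) * outer_coeff p c (- 1 / p) k)"
      using t fin by (subst sum_ennreal[symmetric]) (auto simp: ennreal_mult' intro!: sum.cong simp del: sum_ennreal power_Suc)
    also have "\<dots> = ennreal (\<Sum>k<CARD('n). t ^ Suc k * b k)" by (rule eq[OF t])
    finally have "(\<Sum>k<CARD('n). t ^ Suc k * enn2real (outer_coeff p c (- 1 / p) k)) = (\<Sum>k<CARD('n). t ^ Suc k * b k)"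
      using t b by (subst (asm) ennreal_inj) (auto intro!: sum_nonneg)
    then have "(\<Sum>k<CARD('n). d (Suc k) * t ^ Suc k) = 0"
      by (simp add: d_def left_diff_distrib right_diff_distrib sum_subtractf mult.commute)
    moreover have "(\<Sum>i\<le>CARD('n). d i * t ^ i) = d 0 * t ^ 0 + (\<Sum>k<CARD('n). d (Suc k) * t ^ Suc k)"
      unfolding lessThan_Suc_atMost[symmetric] by (rule sum.lessThan_Suc_shift)
    ultimately show ?thesis by (simp add: d_def)
  qed
  then have sub: "{0..} \<subseteq> {t. (\<Sum>i\<le>CARD('n). d i * t ^ i) = 0}" by auto
  have "d (Suc k) = 0"
  proof (rule ccontr)
    assume "d (Suc k) \<noteq> 0"
    then have "finite {t. (\<Sum>i\<le>CARD('n). d i * t ^ i) = 0}"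
      using k by (intro polyfun_roots_finite[of d "Suc k"]) auto
    then show False using sub finite_subset infinite_Ici by blast
  qed
  then have "enn2real (outer_coeff p c (- 1 / p) k) = b k" by (simp add: d_def)
  then have "outer_coeff p c (- 1 / p) k = ennreal (b k)"
    using fin[OF k] by (metis ennreal_enn2real infinity_ennreal_def)
  then show ?thesis by (simp add: b_def)
qed

end

section \<open>Evaluation of the coefficients\<close>

text \<open>Since \<open>enn2real\<close> is multiplicative without any finiteness condition, working with this extended
  version of \<open>I_fun\<close>, \<open>J_fun\<close> and \<open>K_fun\<close> makes their integrability irrelevant.\<close>

definition exp_moment :: "real \<Rightarrow> real \<Rightarrow> real \<Rightarrow> ennreal" where
  "exp_moment p q \<theta> = (\<integral>\<^sup>+x. ennreal (\<bar>x\<bar> powr q * exp (- (\<bar>x\<bar> powr p) - \<theta> * \<bar>x\<bar> powr (2 * p - 2))) \<partial>lborel)"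

lemma borel_measurable_exp_moment [measurable]: "exp_moment p q \<in> borel_measurable borel"
  unfolding exp_moment_def by measurable

lemma J_fun_eq: "J_fun p \<theta> = enn2real (exp_moment p (p - 2) \<theta>)"
  unfolding J_fun_def exp_moment_def by (rule integral_eq_nn_integral) simp_all

lemma K_fun_eq: "K_fun p \<theta> = enn2real (exp_moment p (2 * p - 2) \<theta>)"
  unfolding K_fun_def exp_moment_def by (rule integral_eq_nn_integral) simp_all

lemma I_fun_eq: "I_fun p \<theta> = enn2real (exp_moment p 0 \<theta>)"
proof -
  have "I_fun p \<theta> = enn2real (\<integral>\<^sup>+x. ennreal (exp (- (\<bar>x\<bar> powr p) - \<theta> * \<bar>x\<bar> powr (2 * p - 2))) \<partial>lborel)"
    unfolding I_fun_def by (rule integral_eq_nn_integral) simp_all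
  also have "(\<integral>\<^sup>+x. ennreal (exp (- (\<bar>x\<bar> powr p) - \<theta> * \<bar>x\<bar> powr (2 * p - 2))) \<partial>lborel) = exp_moment p 0 \<theta>"
    unfolding exp_moment_def
  proof (rule nn_integral_cong_AE)
    show "AE x in lborel. ennreal (exp (- (\<bar>x\<bar> powr p) - \<theta> * \<bar>x\<bar> powr (2 * p - 2))) =
        ennreal (\<bar>x\<bar> powr 0 * exp (- (\<bar>x\<bar> powr p) - \<theta> * \<bar>x\<bar> powr (2 * p - 2)))"
      using AE_lborel_singleton[of 0] by eventually_elim simp
  qed
  finally show ?thesis .
qed

lemma nn_integral_exp_moment_scaled:
  assumes a: "0 < a"
  shows "(\<integral>\<^sup>+x. ennreal (\<bar>a * x\<bar> powr q * exp (- (\<bar>a * x\<bar> powr p) - \<theta> * (a\<^sup>2 * \<bar>a * x\<bar> powr (2 * p - 2)))) \<partial>lborel)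
    = ennreal (inverse a) * exp_moment p q (a\<^sup>2 * \<theta>)"
proof -
  have "(\<integral>\<^sup>+x. ennreal (\<bar>a * x\<bar> powr q * exp (- (\<bar>a * x\<bar> powr p) - \<theta> * (a\<^sup>2 * \<bar>a * x\<bar> powr (2 * p - 2)))) \<partial>lborel)
    = ennreal \<bar>1 / a\<bar> * (\<integral>\<^sup>+x. ennreal (\<bar>a * (0 + 1 / a * x)\<bar> powr q * exp (- (\<bar>a * (0 + 1 / a * x)\<bar> powr p)
        - \<theta> * (a\<^sup>2 * \<bar>a * (0 + 1 / a * x)\<bar> powr (2 * p - 2)))) \<partial>lborel)"
    by (rule nn_integral_real_affine) (use a in simp_all)
  then show ?thesis using a by (simp add: exp_moment_def inverse_eq_divide mult_ac)
qed

text \<open>Scaling \<theta> by \<open>g^2\<close> reduces this to Euler's integral. Read from right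
  to left, it turns \<open>1 / g ^ m\<close> into a mixture of exponentials of \<open>g^2\<close>,
  which split over coordinates when \<open>g\<close> is the norm of the normal.\<close>

lemma nn_integral_gaussian_moment:
  assumes G: "0 < g" and m: "0 < m"
  shows "(\<integral>\<^sup>+\<theta>. ennreal (\<theta> powr (real m / 2 - 1) * exp (- (\<theta> * g\<^sup>2))) * indicator {0<..} \<theta> \<partial>lborel)
    = ennreal (Gamma (real m / 2) * (1 / g) ^ m)"
proof -
  let ?z = "real m / 2 - 1"
  have g: "g\<^sup>2 > 0" using G by simp
  have "(\<integral>\<^sup>+\<theta>. ennreal (\<theta> powr ?z * exp (- (\<theta> * g\<^sup>2))) * indicator {0<..} \<theta> \<partial>lborel)
    = ennreal \<bar>1 / g\<^sup>2\<bar> * (\<integral>\<^sup>+u. ennreal ((0 + 1 / g\<^sup>2 * u) powr ?z * exp (- ((0 + 1 / g\<^sup>2 * u) * g\<^sup>2))) * indicator {0<..} (0 + 1 / g\<^sup>2 * u) \<partial>lborel)"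
    by (rule nn_integral_real_affine) (use G in simp_all)
  also have "\<dots> = ennreal (1 / g\<^sup>2) * (\<integral>\<^sup>+u. ennreal ((1 / g\<^sup>2) powr ?z) * (ennreal (exp (- u) * u powr ?z) * indicator {0<..} u) \<partial>lborel)"
  proof (rule arg_cong2[where f = "(*)"], use g in simp, rule nn_integral_cong)
    fix u :: real
    show "ennreal ((0 + 1 / g\<^sup>2 * u) powr ?z * exp (- ((0 + 1 / g\<^sup>2 * u) * g\<^sup>2))) * indicator {0<..} (0 + 1 / g\<^sup>2 * u) =
      ennreal ((1 / g\<^sup>2) powr ?z) * (ennreal (exp (- u) * u powr ?z) * indicator {0<..} u)"
    proof (cases "0 < u")
      case True
      have "(1 / g\<^sup>2 * u) powr ?z * exp (- ((1 / g\<^sup>2 * u) * g\<^sup>2)) = (1 / g\<^sup>2) powr ?z * (exp (- u) * u powr ?z)"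
        using g True by (subst powr_mult) (auto simp: mult_ac)
      moreover have "0 < 1 / g\<^sup>2 * u" using True g by simp
      ultimately show ?thesis using True by (simp only: add_0_left indicator_simps greaterThan_iff mult_1_right ennreal_mult'[symmetric] powr_ge_zero)
    next
      case False
      then have "\<not> 0 < 1 / g\<^sup>2 * u" using g by (simp add: zero_less_divide_iff)
      then show ?thesis using False by (simp add: indicator_def)
    qed
  qed
  also have "\<dots> = ennreal (1 / g\<^sup>2) * (ennreal ((1 / g\<^sup>2) powr ?z) * ennreal (Gamma (real m / 2)))"
    using m by (subst nn_integral_cmult) (simp_all add: nn_integral_exp_powr)
  also have "\<dots> = ennreal ((1 / g\<^sup>2) * (1 / g\<^sup>2) powr ?z * Gamma (real m / 2))"
    using g by (simp add: ennreal_mult'[symmetric])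
  also have "(1 / g\<^sup>2) * (1 / g\<^sup>2) powr ?z = (1 / g) ^ m"
  proof -
    have "(1 / g\<^sup>2) * (1 / g\<^sup>2) powr ?z = (1 / g\<^sup>2) powr (1 + ?z)"
      using g by (subst powr_mult_base) auto
    also have "\<dots> = ((1 / g) powr 2) powr (real m / 2)"
      using G by (simp add: power_one_over powr_realpow[of "1 / g" 2, simplified])
    also have "\<dots> = (1 / g) ^ m" using G by (subst powr_powr) (simp add: powr_realpow)
    finally show ?thesis .
  qed
  finally show ?thesis by (simp add: mult.commute)
qed

lemma prod_UNIV_split:
  fixes f :: "'n::finite \<Rightarrow> 'b::comm_monoid_mult"
  assumes "I \<subseteq> UNIV - {i}"
  shows "(\<Prod>r\<in>UNIV. f r) = f i * (\<Prod>r\<in>I. f r) * (\<Prod>r\<in>UNIV - (I \<union> {i}). f r)"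
proof -
  have "(\<Prod>r\<in>UNIV. f r) = f i * (\<Prod>r\<in>UNIV - {i}. f r)" by (rule prod.remove) auto
  also have "(\<Prod>r\<in>UNIV - {i}. f r) = (\<Prod>r\<in>UNIV - {i} - I. f r) * (\<Prod>r\<in>I. f r)"
    by (rule prod.subset_diff[OF assms]) simp
  also have "UNIV - {i} - I = UNIV - (I \<union> {i})" by auto
  finally show ?thesis by (simp add: mult_ac)
qed

section \<open>The Steiner formula and factorisation over the coordinates\<close>

lemma parallel_body_eq_infdist:
  fixes K :: "'a::euclidean_space set"
  assumes t: "0 \<le> t" and K: "compact K" "K \<noteq> {}"
  shows "{x + t *\<^sub>R y |x y. x \<in> K \<and> y \<in> cball 0 1} = {z. infdist z K \<le> t}"
proof (intro equalityI subsetI)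
  fix z assume "z \<in> {x + t *\<^sub>R y |x y. x \<in> K \<and> y \<in> cball 0 1}"
  then obtain x y where z: "z = x + t *\<^sub>R y" "x \<in> K" "norm y \<le> 1" by auto
  have "infdist z K \<le> dist z x" using z by (intro infdist_le)
  also have "\<dots> = t * norm y" using z t by (simp add: dist_norm)
  also have "\<dots> \<le> t * 1" using z t by (intro mult_left_mono)
  finally show "z \<in> {z. infdist z K \<le> t}" by simp
next
  fix z assume z: "z \<in> {z. infdist z K \<le> t}"
  obtain x where x: "x \<in> K" "infdist z K = dist z x"
    using infdist_attains_inf[of K z] K compact_imp_closed by metis
  then have d: "dist z x \<le> t" using z by simp
  \<comment> \<open>For \<open>t = 0\<close> the quotient \<open>1 / t\<close> is 0 by convention,
    so the witness is the zero vector, and \<open>d\<close> forces \<open>z = x\<close>.\<close>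
  have "z = x + t *\<^sub>R ((1 / t) *\<^sub>R (z - x)) \<and> (1 / t) *\<^sub>R (z - x) \<in> cball 0 1"
  proof (cases "t = 0")
    case False
    then show ?thesis using d t by (simp add: dist_norm divide_le_eq)
  qed (use d in simp)
  then show "z \<in> {x + t *\<^sub>R y |x y. x \<in> K \<and> y \<in> cball 0 1}" using x(1) by blast
qed

text \<open>The factor of coordinate \<open>r\<close> in the summand of \<open>normal_sum\<close>
  indexed by \<open>i\<close> and \<open>I\<close>, together with its share of the two exponentials;
  both exponents are sums over coordinates.\<close>

definition coord_weight :: "real \<Rightarrow> ('n::finite \<Rightarrow> real) \<Rightarrow> 'n \<Rightarrow> 'n set \<Rightarrow> real \<Rightarrow> 'n \<Rightarrow> real \<Rightarrow> real" where
  "coord_weight p c i I \<theta> r x = exp (- (c r * \<bar>x\<bar> powr p) - \<theta> * (power_grad p (c r) x)\<^sup>2) *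
     (if r = i then (power_grad p (c r) x)\<^sup>2 else if r \<in> I then power_hess p (c r) x else 1)"

lemma prod_coord_weight:
  fixes x :: "real ^ 'n"
  assumes "I \<subseteq> UNIV - {i}"
  shows "(\<Prod>r\<in>UNIV. coord_weight p c i I \<theta> r (x $ r)) =
    exp (- power_sum p c x) * exp (- (\<theta> * (norm (power_normal p c x))\<^sup>2)) *
    ((power_grad p (c i) (x $ i))\<^sup>2 * (\<Prod>r\<in>I. power_hess p (c r) (x $ r)))"
proof -
  have I: "i \<notin> I" using assms by auto
  have "(\<Prod>r\<in>UNIV. if r = i then (power_grad p (c r) (x $ r))\<^sup>2 else if r \<in> I then power_hess p (c r) (x $ r) else 1)
    = (power_grad p (c i) (x $ i))\<^sup>2 * (\<Prod>r\<in>I. power_hess p (c r) (x $ r))"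
    by (subst prod_UNIV_split[OF assms]) (use I in \<open>auto intro!: prod.cong prod.neutral arg_cong2[where f = "(*)"]\<close>)
  moreover have "(\<Prod>r\<in>UNIV. exp (- (c r * \<bar>x $ r\<bar> powr p) - \<theta> * (power_grad p (c r) (x $ r))\<^sup>2)) =
      exp (- power_sum p c x) * exp (- (\<theta> * (norm (power_normal p c x))\<^sup>2))"
    by (simp add: exp_sum[symmetric] exp_add[symmetric] norm_power_normal_sq power_sum_def sum_subtractf sum_negf sum_distrib_left)
  ultimately show ?thesis unfolding coord_weight_def prod.distrib by simp
qed

context
  fixes p :: real and c :: "'n::finite \<Rightarrow> real"
  assumes p: "1 < p" and c: "\<And>r. 0 < c r"
begin

lemma coord_weight_nonneg: "0 \<le> coord_weight p c i I \<theta> r x"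
  using power_hess_nonneg[OF p c] by (simp add: coord_weight_def)

text \<open>With \<open>e = - 1 / p\<close> the power of \<open>F\<close> disappears and only
  \<open>\<bar>g\<bar> ^ (k + 1)\<close> remains in the denominator. The integral over \<theta>
  replaces it, and after Tonelli the integral over \<open>x\<close> is a product of one-dimensional
  ones.\<close>

lemma outer_coeff_theta:
  defines "S k i \<equiv> {I. I \<subseteq> UNIV - {i} \<and> card I = k}"
  shows "outer_coeff p c (- 1 / p) k = ennreal (p / (real (Suc k) * Gamma (real (Suc k) / 2))) *
    (\<Sum>i\<in>UNIV. \<Sum>I\<in>S k i. \<integral>\<^sup>+\<theta>. ennreal (\<theta> powr (real (Suc k) / 2 - 1)) *
      (\<Prod>r\<in>UNIV. \<integral>\<^sup>+x. ennreal (coord_weight p c i I \<theta> r x) \<partial>lborel) * indicator {0<..} \<theta> \<partial>lborel)"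
proof -
  define C where "C = p / (real (Suc k) * Gamma (real (Suc k) / 2))"
  have Gpos: "Gamma (real (Suc k) / 2) > 0" by (rule Gamma_real_pos) simp
  have C: "C \<ge> 0" using p Gpos by (simp add: C_def)
  let ?z = "real (Suc k) / 2 - 1"
  let ?F = "power_sum p c" and ?g = "\<lambda>x. norm (power_normal p c x)"
  let ?w = "\<lambda>i I \<theta> x. \<Prod>r\<in>UNIV. ennreal (coord_weight p c i I \<theta> r (x $ r))"
  have [measurable]: "(\<lambda>w. coord_weight p c i I (f w) r (g w)) \<in> borel_measurable M"
    if [measurable]: "f \<in> borel_measurable M" "g \<in> borel_measurable M" for f g i I r and M :: "'m measure"
    unfolding coord_weight_def by measurable
  have "outer_coeff p c (- 1 / p) k = (\<integral>\<^sup>+x. ennreal C * (\<Sum>i\<in>UNIV. \<Sum>I\<in>S k i.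
      \<integral>\<^sup>+\<theta>. ennreal (\<theta> powr ?z) * ?w i I \<theta> x * indicator {0<..} \<theta> \<partial>lborel) \<partial>lborel)"
    unfolding outer_coeff_def
  proof (rule nn_integral_cong_AE)
    show "AE x in lborel. ennreal (exp (- ?F x) * ((?F x powr (- 1 / p + 1 / p) / ?g x) ^ Suc k * (p * normal_sum p c k x) / real (Suc k)))
      = ennreal C * (\<Sum>i\<in>UNIV. \<Sum>I\<in>S k i. \<integral>\<^sup>+\<theta>. ennreal (\<theta> powr ?z) * ?w i I \<theta> x * indicator {0<..} \<theta> \<partial>lborel)"
      using AE_lborel_vec_nonzero
    proof eventually_elim
      case (elim x)
      then have "x \<noteq> 0" by auto
      then have F: "?F x > 0" by (rule power_sum_pos[OF p c])
      have "power_normal p c x \<noteq> 0"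
        using elim power_grad_eq_0_iff[OF p c] by (auto simp: power_normal_def vec_eq_iff)
      then have g: "?g x > 0" by simp
      define Q where "Q i I = (power_grad p (c i) (x $ i))\<^sup>2 * (\<Prod>r\<in>I. power_hess p (c r) (x $ r))" for i I
      have Q: "0 \<le> Q i I" for i I
        unfolding Q_def by (intro mult_nonneg_nonneg prod_nonneg power_hess_nonneg p c) simp
      define E where "E = Gamma (real (Suc k) / 2) * (1 / ?g x) ^ Suc k"
      have E: "E \<ge> 0" using Gpos g by (simp add: E_def)
      have "(\<integral>\<^sup>+\<theta>. ennreal (\<theta> powr ?z) * ?w i I \<theta> x * indicator {0<..} \<theta> \<partial>lborel) = ennreal (exp (- ?F x) * Q i I * E)"
        if I: "I \<in> S k i" for i I
      proof -
        have "I \<subseteq> UNIV - {i}" using I by (simp add: S_def)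
        note w = prod_coord_weight[OF this]
        have "(\<integral>\<^sup>+\<theta>. ennreal (\<theta> powr ?z) * ?w i I \<theta> x * indicator {0<..} \<theta> \<partial>lborel) =
          (\<integral>\<^sup>+\<theta>. ennreal (exp (- ?F x) * Q i I) * (ennreal (\<theta> powr ?z * exp (- (\<theta> * (?g x)\<^sup>2))) * indicator {0<..} \<theta>) \<partial>lborel)"
        proof (rule nn_integral_cong)
          fix \<theta> :: real
          have "?w i I \<theta> x = ennreal (exp (- ?F x) * exp (- (\<theta> * (?g x)\<^sup>2)) * Q i I)"
            unfolding Q_def w[symmetric] by (rule prod_ennreal) (rule coord_weight_nonneg)
          then have "ennreal (\<theta> powr ?z) * ?w i I \<theta> x = ennreal (\<theta> powr ?z * (exp (- ?F x) * exp (- (\<theta> * (?g x)\<^sup>2)) * Q i I))"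
            by (simp add: ennreal_mult')
          also have "\<theta> powr ?z * (exp (- ?F x) * exp (- (\<theta> * (?g x)\<^sup>2)) * Q i I) = (exp (- ?F x) * Q i I) * (\<theta> powr ?z * exp (- (\<theta> * (?g x)\<^sup>2)))"
            by (simp only: mult_ac)
          also have "ennreal \<dots> = ennreal (exp (- ?F x) * Q i I) * ennreal (\<theta> powr ?z * exp (- (\<theta> * (?g x)\<^sup>2)))"
            by (rule ennreal_mult') (use Q in simp)
          finally show "ennreal (\<theta> powr ?z) * ?w i I \<theta> x * indicator {0<..} \<theta> =
            ennreal (exp (- ?F x) * Q i I) * (ennreal (\<theta> powr ?z * exp (- (\<theta> * (?g x)\<^sup>2))) * indicator {0<..} \<theta>)"
            by (simp only: mult.assoc)
        qed
        also have "\<dots> = ennreal (exp (- ?F x) * Q i I) * ennreal E"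
          unfolding E_def by (subst nn_integral_cmult, simp, subst nn_integral_gaussian_moment[OF g]) simp_all
        finally show ?thesis using Q E by (simp add: ennreal_mult')
      qed
      then have "(\<Sum>i\<in>UNIV. \<Sum>I\<in>S k i. \<integral>\<^sup>+\<theta>. ennreal (\<theta> powr ?z) * ?w i I \<theta> x * indicator {0<..} \<theta> \<partial>lborel)
        = (\<Sum>i\<in>UNIV. \<Sum>I\<in>S k i. ennreal (exp (- ?F x) * Q i I * E))"
        by simp
      also have "\<dots> = ennreal (\<Sum>i\<in>UNIV. \<Sum>I\<in>S k i. exp (- ?F x) * Q i I * E)"
        using Q E by (simp add: sum_nonneg)
      also have "(\<Sum>i\<in>UNIV. \<Sum>I\<in>S k i. exp (- ?F x) * Q i I * E) = exp (- ?F x) * normal_sum p c k x * E"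
        unfolding normal_sum_def Q_def S_def by (simp add: sum_distrib_left sum_distrib_right)
      finally have "ennreal C * (\<Sum>i\<in>UNIV. \<Sum>I\<in>S k i. \<integral>\<^sup>+\<theta>. ennreal (\<theta> powr ?z) * ?w i I \<theta> x * indicator {0<..} \<theta> \<partial>lborel)
        = ennreal (C * (exp (- ?F x) * normal_sum p c k x * E))"
        using C by (simp add: ennreal_mult')
      \<comment> \<open>The exponent of \<open>F x\<close> is 0, and that power equals 1 because
        \<open>F x > 0\<close>; the Gamma factor in \<open>E\<close> cancels the one in
        \<open>C\<close>.\<close>
      also have "C * (exp (- ?F x) * normal_sum p c k x * E) = exp (- ?F x) * ((?F x powr (- 1 / p + 1 / p) / ?g x) ^ Suc k * (p * normal_sum p c k x) / real (Suc k))"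
        using F Gpos[THEN less_imp_neq, symmetric] by (simp add: C_def E_def del: power_Suc of_nat_Suc)
      finally show ?case by simp
    qed
  qed
  also have "\<dots> = ennreal C * (\<Sum>i\<in>UNIV. \<Sum>I\<in>S k i. \<integral>\<^sup>+x. \<integral>\<^sup>+\<theta>. ennreal (\<theta> powr ?z) * ?w i I \<theta> x * indicator {0<..} \<theta> \<partial>lborel \<partial>lborel)"
    by (simp add: nn_integral_cmult nn_integral_sum)
  also have "\<dots> = ennreal C * (\<Sum>i\<in>UNIV. \<Sum>I\<in>S k i. \<integral>\<^sup>+\<theta>. ennreal (\<theta> powr ?z) *
      (\<Prod>r\<in>UNIV. \<integral>\<^sup>+x. ennreal (coord_weight p c i I \<theta> r x) \<partial>lborel) * indicator {0<..} \<theta> \<partial>lborel)"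
  proof (intro arg_cong2[where f = "(*)"] refl sum.cong)
    fix i I
    have "(\<integral>\<^sup>+(x::real^'n). \<integral>\<^sup>+\<theta>. ennreal (\<theta> powr ?z) * ?w i I \<theta> x * indicator {0<..} \<theta> \<partial>lborel \<partial>lborel) =
      (\<integral>\<^sup>+\<theta>. \<integral>\<^sup>+(x::real^'n). ennreal (\<theta> powr ?z) * ?w i I \<theta> x * indicator {0<..} \<theta> \<partial>lborel \<partial>lborel)"
      by (rule lborel_pair.Fubini') simp
    also have "\<dots> = (\<integral>\<^sup>+\<theta>. ennreal (\<theta> powr ?z) * (\<Prod>r\<in>UNIV. \<integral>\<^sup>+x. ennreal (coord_weight p c i I \<theta> r x) \<partial>lborel) * indicator {0<..} \<theta> \<partial>lborel)"
    proof (rule nn_integral_cong)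
      fix \<theta> :: real
      have "(\<integral>\<^sup>+(x::real^'n). ?w i I \<theta> x \<partial>lborel) = (\<Prod>r\<in>UNIV. \<integral>\<^sup>+x. ennreal (coord_weight p c i I \<theta> r x) \<partial>lborel)"
        by (rule nn_integral_lborel_vec_prod) simp
      then show "(\<integral>\<^sup>+(x::real^'n). ennreal (\<theta> powr ?z) * ?w i I \<theta> x * indicator {0<..} \<theta> \<partial>lborel) =
        ennreal (\<theta> powr ?z) * (\<Prod>r\<in>UNIV. \<integral>\<^sup>+x. ennreal (coord_weight p c i I \<theta> r x) \<partial>lborel) * indicator {0<..} \<theta>"
        by (subst nn_integral_multc, simp, subst nn_integral_cmult, simp, simp only:)
    qed
    finally show "(\<integral>\<^sup>+(x::real^'n). \<integral>\<^sup>+\<theta>. ennreal (\<theta> powr ?z) * ?w i I \<theta> x * indicator {0<..} \<theta> \<partial>lborel \<partial>lborel) = \<dots>" .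
  qed
  finally show ?thesis unfolding C_def .
qed

text \<open>The power \<open>t ^ (n - j)\<close> belongs to the coefficient with index
  \<open>k = n - 1 - j\<close>, since the shell polynomial starts at \<open>t ^ 1\<close>. The
  constant term is the volume of the body, which is the value at \<open>j = n\<close>.\<close>

lemma steiner_formula_sublevel:
  defines "K \<equiv> {z. power_sum p c z \<le> 1}"
  shows "steiner_formula K (\<lambda>j. if j < CARD('n) then steiner_coeff p c (CARD('n) - 1 - j) / unit_ball_vol (real (CARD('n) - j))
     else measure lborel K)" (is "steiner_formula K ?V")
  unfolding steiner_formula_def
proof (intro allI impI)
  fix t :: real assume t: "0 \<le> t"
  let ?A = "{z. infdist z K \<le> t}"
  have comp: "compact K" unfolding K_def by (rule compact_sublevel[of p c, OF p c])
  have "power_sum p c 0 = 0" using p by (simp add: power_sum_def)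
  then have ne: "K \<noteq> {}" by (auto simp: K_def intro: exI[of _ 0])
  have "K \<in> sets lborel" using comp by (simp add: borel_compact)
  have "closed ?A" by (intro closed_Collect_le continuous_intros)
  then have "?A \<in> sets lborel" by simp
  have fin: "emeasure lborel K < \<infinity>" using comp by (intro emeasure_bounded_finite compact_imp_bounded)
  have "K \<subseteq> ?A" using t by auto
  have S: "0 \<le> (\<Sum>k<CARD('n). t ^ Suc k * steiner_coeff p c k)"
    using t steiner_coeff_nonneg[of p c, OF p c] by (intro sum_nonneg) simp
  have "emeasure lborel ?A = emeasure lborel K + emeasure lborel (?A - K)"
    using \<open>K \<subseteq> ?A\<close> \<open>K \<in> sets lborel\<close> \<open>?A \<in> sets lborel\<close>
    by (subst plus_emeasure) (auto intro!: arg_cong[where f = "emeasure lborel"])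
  also have "emeasure lborel (?A - K) = ennreal (\<Sum>k<CARD('n). t ^ Suc k * steiner_coeff p c k)"
    using outer_volume_eq[of p c, OF p c t] by (simp add: outer_volume_def K_def)
  also have "emeasure lborel K = ennreal (measure lborel K)"
    using fin by (simp add: emeasure_eq_ennreal_measure top.not_eq_extremum)
  finally have "emeasure lborel ?A = ennreal (measure lborel K + (\<Sum>k<CARD('n). t ^ Suc k * steiner_coeff p c k))"
    using S by simp
  then have m: "measure lborel ?A = measure lborel K + (\<Sum>k<CARD('n). t ^ Suc k * steiner_coeff p c k)"
    using S by (intro measure_eq_emeasure_eq_ennreal) simp_all
  \<comment> \<open>Summing by the exponent of \<open>t\<close> lets the constant term split off as
    the first summand.\<close>
  have "(\<Sum>j\<le>CARD('n). unit_ball_vol (real (CARD('n) - j)) * ?V j * t ^ (CARD('n) - j)) =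
    (\<Sum>i\<le>CARD('n). unit_ball_vol (real i) * ?V (CARD('n) - i) * t ^ i)"
    by (rule sum.reindex_bij_witness[of _ "\<lambda>i. CARD('n) - i" "\<lambda>i. CARD('n) - i"]) auto
  also have "\<dots> = unit_ball_vol (real 0) * ?V (CARD('n) - 0) * t ^ 0 +
     (\<Sum>k<CARD('n). unit_ball_vol (real (Suc k)) * ?V (CARD('n) - Suc k) * t ^ Suc k)"
    unfolding lessThan_Suc_atMost[symmetric] by (rule sum.lessThan_Suc_shift)
  also have "(\<Sum>k<CARD('n). unit_ball_vol (real (Suc k)) * ?V (CARD('n) - Suc k) * t ^ Suc k) =
     (\<Sum>k<CARD('n). t ^ Suc k * steiner_coeff p c k)"
  proof (rule sum.cong[OF refl])
    fix k assume k: "k \<in> {..<CARD('n)}"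
    then have "CARD('n) - Suc k < CARD('n)" "CARD('n) - (CARD('n) - Suc k) = Suc k" "CARD('n) - 1 - (CARD('n) - Suc k) = k" by auto
    moreover have "unit_ball_vol (real (Suc k)) \<noteq> 0" using unit_ball_vol_pos[of "real (Suc k)"] by linarith
    ultimately show "unit_ball_vol (real (Suc k)) * ?V (CARD('n) - Suc k) * t ^ Suc k = t ^ Suc k * steiner_coeff p c k"
      by (simp only: if_True) simp
  qed
  finally show "measure lborel {x + t *\<^sub>R y |x y. x \<in> K \<and> y \<in> cball 0 1} =
        (\<Sum>j\<le>DIM(real ^ 'n). unit_ball_vol (real (DIM(real ^ 'n) - j)) * ?V j * t ^ (DIM(real ^ 'n) - j))"
    unfolding parallel_body_eq_infdist[OF t comp ne] m by (simp add: unit_ball_vol_def)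
qed

end

section \<open>Specialisation to the weights of the ball\<close>

definition theta_density :: "real \<Rightarrow> ('n::finite \<Rightarrow> real) \<Rightarrow> nat \<Rightarrow> 'n \<Rightarrow> 'n set \<Rightarrow> real \<Rightarrow> ennreal" where
  "theta_density p a m i I \<theta> = ennreal (\<theta> powr (real m / 2 - 1)) * (ennreal (a i) * exp_moment p (2 * p - 2) ((a i)\<^sup>2 * \<theta>))
     * (\<Prod>r\<in>I. ennreal (a r) * exp_moment p (p - 2) ((a r)\<^sup>2 * \<theta>))
     * (\<Prod>r\<in>UNIV - (I \<union> {i}). ennreal (inverse (a r)) * exp_moment p 0 ((a r)\<^sup>2 * \<theta>))"

lemma enn2real_prod: "enn2real (\<Prod>r\<in>A. f r) = (\<Prod>r\<in>A. enn2real (f r))"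
  by (induction A rule: infinite_finite_induct) (simp_all add: enn2real_mult)

context
  fixes p :: real and a c :: "'n::finite \<Rightarrow> real"
  assumes p: "1 < p" and a: "\<And>r. 0 < a r"
  defines c_def: "c \<equiv> \<lambda>r. a r powr p"
begin

text \<open>With \<open>c r = a r powr p\<close>, everything depends on \<open>a r * x\<close>, up
  to a factor \<open>(a r)^2\<close> in the squared gradient and in the second derivative. The
  substitution costs \<open>1 / a r\<close>, which leaves the weights \<open>a r\<close>,
  \<open>a r\<close> and \<open>1 / a r\<close>.\<close>

lemma nn_integral_coord_weight:
  "(\<integral>\<^sup>+x. ennreal (coord_weight p c i I \<theta> r x) \<partial>lborel) =
    (if r = i then ennreal (a r) * exp_moment p (2 * p - 2) ((a r)\<^sup>2 * \<theta>)
     else if r \<in> I then ennreal (p - 1) * (ennreal (a r) * exp_moment p (p - 2) ((a r)\<^sup>2 * \<theta>))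
     else ennreal (inverse (a r)) * exp_moment p 0 ((a r)\<^sup>2 * \<theta>))"
proof -
  have cpos: "0 < c r" for r using a[of r] by (simp add: c_def)
  define w where "w q x = \<bar>a r * x\<bar> powr q * exp (- (\<bar>a r * x\<bar> powr p) - \<theta> * ((a r)\<^sup>2 * \<bar>a r * x\<bar> powr (2 * p - 2)))" for q x
  have w: "(\<integral>\<^sup>+x. ennreal (w q x) \<partial>lborel) = ennreal (inverse (a r)) * exp_moment p q ((a r)\<^sup>2 * \<theta>)" for q
    unfolding w_def by (rule nn_integral_exp_moment_scaled) (rule a)
  have [measurable]: "w q \<in> borel_measurable borel" for q unfolding w_def by measurable
  have F: "c r * \<bar>x\<bar> powr p = \<bar>a r * x\<bar> powr p" for x
    using a[of r] by (simp add: c_def abs_mult powr_mult)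
  have G: "(power_grad p (c r) x)\<^sup>2 = (a r)\<^sup>2 * \<bar>a r * x\<bar> powr (2 * p - 2)" for x
  proof -
    have "(c r)\<^sup>2 = a r powr (2 + (2 * p - 2))"
      unfolding c_def by (simp add: power2_eq_square powr_add[symmetric])
    also have "\<dots> = (a r)\<^sup>2 * a r powr (2 * p - 2)"
      using a[of r] by (simp only: powr_add) (simp add: powr_realpow[of "a r" 2, simplified])
    finally show ?thesis
      using a[of r] unfolding power_grad_sq[OF p cpos] by (simp add: abs_mult powr_mult)
  qed
  have H: "power_hess p (c r) x = (p - 1) * (a r)\<^sup>2 * \<bar>a r * x\<bar> powr (p - 2)" for x
  proof -
    have "c r = a r powr (2 + (p - 2))" by (simp add: c_def)
    also have "\<dots> = (a r)\<^sup>2 * a r powr (p - 2)"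
      using a[of r] by (simp only: powr_add) (simp add: powr_realpow[of "a r" 2, simplified])
    finally show ?thesis
      using a[of r] by (simp add: power_hess_def abs_mult powr_mult)
  qed
  have aa: "ennreal ((a r)\<^sup>2) * (ennreal (inverse (a r)) * X) = ennreal (a r) * X" for X
  proof -
    have "(a r)\<^sup>2 * inverse (a r) = a r" using a[of r] by (simp add: power2_eq_square field_simps)
    then have "ennreal ((a r)\<^sup>2) * ennreal (inverse (a r)) = ennreal (a r)" by (simp add: ennreal_mult'[symmetric])
    then show ?thesis by (simp add: mult.assoc[symmetric])
  qed
  consider "r = i" | "r \<noteq> i" "r \<in> I" | "r \<noteq> i" "r \<notin> I" by blast
  then show ?thesis
  proof cases
    case 1
    have "(\<integral>\<^sup>+x. ennreal (coord_weight p c i I \<theta> r x) \<partial>lborel) = (\<integral>\<^sup>+x. ennreal ((a r)\<^sup>2) * ennreal (w (2 * p - 2) x) \<partial>lborel)"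
      unfolding coord_weight_def F G using 1
      by (intro nn_integral_cong) (simp add: w_def ennreal_mult'[symmetric] mult_ac)
    also have "\<dots> = ennreal (a r) * exp_moment p (2 * p - 2) ((a r)\<^sup>2 * \<theta>)"
      by (simp add: nn_integral_cmult w aa)
    finally show ?thesis using 1 by simp
  next
    case 2
    have "(\<integral>\<^sup>+x. ennreal (coord_weight p c i I \<theta> r x) \<partial>lborel) = (\<integral>\<^sup>+x. ennreal (p - 1) * (ennreal ((a r)\<^sup>2) * ennreal (w (p - 2) x)) \<partial>lborel)"
      unfolding coord_weight_def F G H using 2 p
      by (intro nn_integral_cong) (simp add: w_def ennreal_mult'[symmetric] mult_ac)
    also have "\<dots> = ennreal (p - 1) * (ennreal (a r) * exp_moment p (p - 2) ((a r)\<^sup>2 * \<theta>))"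
      by (simp add: nn_integral_cmult w aa)
    finally show ?thesis using 2 by simp
  next
    case 3
    \<comment> \<open>Equality holds only almost everywhere, because \<open>0 powr 0\<close> is 0
      and not 1.\<close>
    have "(\<integral>\<^sup>+x. ennreal (coord_weight p c i I \<theta> r x) \<partial>lborel) = (\<integral>\<^sup>+x. ennreal (w 0 x) \<partial>lborel)"
    proof (rule nn_integral_cong_AE)
      show "AE x in lborel. ennreal (coord_weight p c i I \<theta> r x) = ennreal (w 0 x)"
        using AE_lborel_singleton[of 0]
        by eventually_elim (use 3 a[of r] in \<open>simp add: coord_weight_def F G w_def\<close>)
    qed
    then show ?thesis using 3 by (simp add: w)
  qed
qed

lemma outer_coeff_theta_density:
  "outer_coeff p c (- 1 / p) k = ennreal (p * (p - 1) ^ k / (real (Suc k) * Gamma (real (Suc k) / 2))) *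
    (\<Sum>i\<in>UNIV. \<Sum>I\<in>{I. I \<subseteq> UNIV - {i} \<and> card I = k}. \<integral>\<^sup>+\<theta>. theta_density p a (Suc k) i I \<theta> * indicator {0<..} \<theta> \<partial>lborel)"
proof -
  have cpos: "0 < c r" for r using a[of r] by (simp add: c_def)
  have Gpos: "Gamma (real (Suc k) / 2) > 0" by (rule Gamma_real_pos) simp
  have [measurable]: "theta_density p a m i I \<in> borel_measurable borel" for m i I
    unfolding theta_density_def by measurable
  have *: "(\<integral>\<^sup>+\<theta>. ennreal (\<theta> powr (real (Suc k) / 2 - 1)) *
      (\<Prod>r\<in>UNIV. \<integral>\<^sup>+x. ennreal (coord_weight p c i I \<theta> r x) \<partial>lborel) * indicator {0<..} \<theta> \<partial>lborel)
      = ennreal ((p - 1) ^ k) * (\<integral>\<^sup>+\<theta>. theta_density p a (Suc k) i I \<theta> * indicator {0<..} \<theta> \<partial>lborel)"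
    if I: "I \<subseteq> UNIV - {i}" "card I = k" for i I
  proof -
    have "(\<integral>\<^sup>+\<theta>. ennreal (\<theta> powr (real (Suc k) / 2 - 1)) *
      (\<Prod>r\<in>UNIV. \<integral>\<^sup>+x. ennreal (coord_weight p c i I \<theta> r x) \<partial>lborel) * indicator {0<..} \<theta> \<partial>lborel)
      = (\<integral>\<^sup>+\<theta>. ennreal ((p - 1) ^ k) * (theta_density p a (Suc k) i I \<theta> * indicator {0<..} \<theta>) \<partial>lborel)"
    proof (rule nn_integral_cong)
      fix \<theta> :: real
      let ?M = "\<lambda>q r. exp_moment p q ((a r)\<^sup>2 * \<theta>)"
      have "(\<Prod>r\<in>UNIV. \<integral>\<^sup>+x. ennreal (coord_weight p c i I \<theta> r x) \<partial>lborel) =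
        (ennreal (a i) * ?M (2 * p - 2) i) * (\<Prod>r\<in>I. ennreal (p - 1) * (ennreal (a r) * ?M (p - 2) r)) *
        (\<Prod>r\<in>UNIV - (I \<union> {i}). ennreal (inverse (a r)) * ?M 0 r)"
        unfolding nn_integral_coord_weight prod_UNIV_split[OF I(1)]
        by (intro arg_cong2[where f = "(*)"] prod.cong) (use I in auto)
      also have "(\<Prod>r\<in>I. ennreal (p - 1) * (ennreal (a r) * ?M (p - 2) r)) =
         ennreal ((p - 1) ^ k) * (\<Prod>r\<in>I. ennreal (a r) * ?M (p - 2) r)"
        using p I(2) unfolding prod.distrib[of "\<lambda>_. ennreal (p - 1)"] by (simp add: ennreal_power)
      finally show "ennreal (\<theta> powr (real (Suc k) / 2 - 1)) *
        (\<Prod>r\<in>UNIV. \<integral>\<^sup>+x. ennreal (coord_weight p c i I \<theta> r x) \<partial>lborel) * indicator {0<..} \<theta> =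
        ennreal ((p - 1) ^ k) * (theta_density p a (Suc k) i I \<theta> * indicator {0<..} \<theta>)"
        unfolding theta_density_def by (simp only: mult_ac)
    qed
    also have "\<dots> = ennreal ((p - 1) ^ k) * (\<integral>\<^sup>+\<theta>. theta_density p a (Suc k) i I \<theta> * indicator {0<..} \<theta> \<partial>lborel)"
      by (rule nn_integral_cmult) simp
    finally show ?thesis .
  qed
  have "outer_coeff p c (- 1 / p) k = ennreal (p / (real (Suc k) * Gamma (real (Suc k) / 2))) *
    (\<Sum>i\<in>UNIV. \<Sum>I\<in>{I. I \<subseteq> UNIV - {i} \<and> card I = k}. ennreal ((p - 1) ^ k) * (\<integral>\<^sup>+\<theta>. theta_density p a (Suc k) i I \<theta> * indicator {0<..} \<theta> \<partial>lborel))"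
    unfolding outer_coeff_theta[OF p cpos]
    by (intro arg_cong2[where f = "(*)"] sum.cong refl, rule *) auto
  also have "\<dots> = ennreal (p * (p - 1) ^ k / (real (Suc k) * Gamma (real (Suc k) / 2))) *
    (\<Sum>i\<in>UNIV. \<Sum>I\<in>{I. I \<subseteq> UNIV - {i} \<and> card I = k}. \<integral>\<^sup>+\<theta>. theta_density p a (Suc k) i I \<theta> * indicator {0<..} \<theta> \<partial>lborel)"
    using p Gpos unfolding sum_distrib_left[symmetric] mult.assoc[symmetric]
    by (intro arg_cong2[where f = "(*)"] refl) (simp add: ennreal_mult'[symmetric] del: of_nat_Suc)
  finally show ?thesis .
qed

text \<open>The real integrand is \<open>enn2real\<close> of the density. Finiteness of the integral
  makes the density finite almost everywhere, so the passage to real numbers loses nothing.\<close>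

lemma LBINT_theta_density:
  assumes fin: "(\<integral>\<^sup>+\<theta>. theta_density p a m i I \<theta> * indicator {0<..} \<theta> \<partial>lborel) < \<infinity>"
  shows "(LBINT \<theta>:{0<..}. \<theta> powr (real m / 2 - 1)
          * (a i * K_fun p ((a i)\<^sup>2 * \<theta>))
          * (\<Prod>r\<in>I. a r * J_fun p ((a r)\<^sup>2 * \<theta>))
          * (\<Prod>r\<in>UNIV - (I \<union> {i}). inverse (a r) * I_fun p ((a r)\<^sup>2 * \<theta>)))
    = enn2real (\<integral>\<^sup>+\<theta>. theta_density p a m i I \<theta> * indicator {0<..} \<theta> \<partial>lborel)"
proof -
  have [measurable]: "theta_density p a m i I \<in> borel_measurable borel"
    unfolding theta_density_def by measurable
  have e: "enn2real (theta_density p a m i I \<theta>) = \<theta> powr (real m / 2 - 1)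
          * (a i * K_fun p ((a i)\<^sup>2 * \<theta>))
          * (\<Prod>r\<in>I. a r * J_fun p ((a r)\<^sup>2 * \<theta>))
          * (\<Prod>r\<in>UNIV - (I \<union> {i}). inverse (a r) * I_fun p ((a r)\<^sup>2 * \<theta>))" for \<theta>
    using a by (simp add: theta_density_def enn2real_mult enn2real_prod I_fun_eq J_fun_eq K_fun_eq less_imp_le)
  have "(LBINT \<theta>:{0<..}. \<theta> powr (real m / 2 - 1)
          * (a i * K_fun p ((a i)\<^sup>2 * \<theta>))
          * (\<Prod>r\<in>I. a r * J_fun p ((a r)\<^sup>2 * \<theta>))
          * (\<Prod>r\<in>UNIV - (I \<union> {i}). inverse (a r) * I_fun p ((a r)\<^sup>2 * \<theta>)))
     = (LINT \<theta>|lborel. enn2real (theta_density p a m i I \<theta> * indicator {0<..} \<theta>))"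
    unfolding set_lebesgue_integral_def e[symmetric]
    by (intro Bochner_Integration.integral_cong) (simp_all add: enn2real_mult indicator_def)
  also have "\<dots> = enn2real (\<integral>\<^sup>+\<theta>. ennreal (enn2real (theta_density p a m i I \<theta> * indicator {0<..} \<theta>)) \<partial>lborel)"
    by (rule integral_eq_nn_integral) simp_all
  also have "(\<integral>\<^sup>+\<theta>. ennreal (enn2real (theta_density p a m i I \<theta> * indicator {0<..} \<theta>)) \<partial>lborel)
     = (\<integral>\<^sup>+\<theta>. theta_density p a m i I \<theta> * indicator {0<..} \<theta> \<partial>lborel)"
  proof (rule nn_integral_cong_AE)
    have "AE \<theta> in lborel. theta_density p a m i I \<theta> * indicator {0<..} \<theta> \<noteq> \<infinity>"
      by (rule nn_integral_noteq_infinite) (use fin in auto)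
    then show "AE \<theta> in lborel. ennreal (enn2real (theta_density p a m i I \<theta> * indicator {0<..} \<theta>)) =
        theta_density p a m i I \<theta> * indicator {0<..} \<theta>"
      by eventually_elim (simp add: top.not_eq_extremum)
  qed
  finally show ?thesis .
qed

text \<open>Real form of the comparison between \<open>outer_coeff_eq\<close> and
  \<open>outer_coeff_theta_density\<close>. The left side is a real number and the prefactor is
  positive, so every integral over \<theta> must be finite.\<close>

lemma weighted_intrinsic_coeff:
  assumes k: "k < CARD('n)"
  shows "steiner_coeff p c k * Gamma (1 + real (CARD('n) - Suc k) / p) =
    p * (p - 1) ^ k / (real (Suc k) * Gamma (real (Suc k) / 2)) *
    (\<Sum>i\<in>UNIV. \<Sum>I\<in>{I. I \<subseteq> UNIV - {i} \<and> card I = k}.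
       (LBINT \<theta>:{0<..}. \<theta> powr (real (Suc k) / 2 - 1)
          * (a i * K_fun p ((a i)\<^sup>2 * \<theta>))
          * (\<Prod>r\<in>I. a r * J_fun p ((a r)\<^sup>2 * \<theta>))
          * (\<Prod>r\<in>UNIV - (I \<union> {i}). inverse (a r) * I_fun p ((a r)\<^sup>2 * \<theta>))))"
    (is "?L = ?A * (\<Sum>i\<in>UNIV. \<Sum>I\<in>?S i. ?B i I)")
proof -
  have cpos: "0 < c r" for r using a[of r] by (simp add: c_def)
  have Gpos: "Gamma (real (Suc k) / 2) > 0" by (rule Gamma_real_pos) simp
  have A: "0 < ?A" using p Gpos by (simp del: of_nat_Suc)
  have "0 < 1 + real (CARD('n) - Suc k) / p" using p by (intro add_pos_nonneg) auto
  then have L: "0 \<le> ?L"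
    using steiner_coeff_nonneg[of p c, OF p cpos] by (intro mult_nonneg_nonneg less_imp_le[OF Gamma_real_pos])
  define X where "X i I = (\<integral>\<^sup>+\<theta>. theta_density p a (Suc k) i I \<theta> * indicator {0<..} \<theta> \<partial>lborel)" for i I
  have eq: "ennreal ?L = ennreal ?A * (\<Sum>i\<in>UNIV. \<Sum>I\<in>?S i. X i I)"
    unfolding X_def outer_coeff_theta_density[symmetric] by (rule outer_coeff_eq[of p c, OF p cpos k, symmetric])
  have "(\<Sum>i\<in>UNIV. \<Sum>I\<in>?S i. X i I) \<noteq> \<infinity>"
  proof
    assume *: "(\<Sum>i\<in>UNIV. \<Sum>I\<in>?S i. X i I) = \<infinity>"
    have "ennreal ?A \<noteq> 0" using A by (simp only: ennreal_eq_0_iff not_le)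
    then have "ennreal ?L = top" unfolding eq * by (simp only: infinity_ennreal_def ennreal_mult_top if_False)
    then show False by (simp only: ennreal_neq_top)
  qed
  then have fin: "X i I < \<infinity>" if "I \<in> ?S i" for i I
    using that by (simp add: top.not_eq_extremum)
  have B: "?B i I = enn2real (X i I)" if "I \<in> ?S i" for i I
    unfolding X_def by (rule LBINT_theta_density) (rule fin[OF that, unfolded X_def])
  have "(\<Sum>i\<in>UNIV. \<Sum>I\<in>?S i. X i I) = (\<Sum>i\<in>UNIV. \<Sum>I\<in>?S i. ennreal (enn2real (X i I)))"
    using fin by (intro sum.cong refl) simp
  also have "\<dots> = ennreal (\<Sum>i\<in>UNIV. \<Sum>I\<in>?S i. enn2real (X i I))"
    by (simp add: sum_nonneg)
  finally have "ennreal ?L = ennreal (?A * (\<Sum>i\<in>UNIV. \<Sum>I\<in>?S i. enn2real (X i I)))"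
    using A by (simp only: eq ennreal_mult'[symmetric] less_imp_le)
  moreover have "0 \<le> (\<Sum>i\<in>UNIV. \<Sum>I\<in>?S i. enn2real (X i I))" by (intro sum_nonneg) simp
  ultimately have "?L = ?A * (\<Sum>i\<in>UNIV. \<Sum>I\<in>?S i. enn2real (X i I))"
    using L A by (subst (asm) ennreal_inj) (simp_all only: mult_nonneg_nonneg less_imp_le)
  also have "(\<Sum>i\<in>UNIV. \<Sum>I\<in>?S i. enn2real (X i I)) = (\<Sum>i\<in>UNIV. \<Sum>I\<in>?S i. ?B i I)"
    by (intro sum.cong refl, rule B[symmetric])
  finally show ?thesis .
qed

end

theorem theorem2p7:
  fixes p :: real and a :: "real ^ 'n" and j :: nat
  assumes "1 < p"
    and "CARD('n) \<ge> 2"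
    and "\<And>r. a $ r > 0"
    and "j < CARD('n)"
  shows "intrinsic_volume j (weighted_lp_ball p a) =
    p * (p - 1) ^ (CARD('n) - 1 - j) / (2 * pi powr (real (CARD('n) - j) / 2) * Gamma (1 + real j / p)) *
    (\<Sum>i\<in>UNIV. \<Sum>I\<in>{I. I \<subseteq> UNIV - {i} \<and> card I = CARD('n) - 1 - j}.
       (LBINT \<theta>:{0<..}. \<theta> powr (real (CARD('n) - j) / 2 - 1)
          * (a $ i * K_fun p ((a $ i)\<^sup>2 * \<theta>))
          * (\<Prod>r\<in>I. a $ r * J_fun p ((a $ r)\<^sup>2 * \<theta>))
          * (\<Prod>r\<in>UNIV - (I \<union> {i}). inverse (a $ r) * I_fun p ((a $ r)\<^sup>2 * \<theta>))))"
    (is "_ = ?C * ?S")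
proof -
  define c where "c = (\<lambda>r. (a $ r) powr p)"
  \<comment> \<open>The power of \<open>s\<close> that contributes to the j-th intrinsic volume;
    then \<open>k + 1 = n - j\<close> is the exponent of \<open>t\<close>.\<close>
  define k where "k = CARD('n) - 1 - j"
  have k: "k < CARD('n)" "CARD('n) - Suc k = j" "Suc k = CARD('n) - j" using assms(4) by (auto simp: k_def)
  have c: "0 < c r" for r using assms(3)[of r] by (simp add: c_def)
  have ball: "weighted_lp_ball p a = {z. power_sum p c z \<le> 1}"
    using assms(3) by (simp add: weighted_lp_ball_def power_sum_def c_def abs_mult powr_mult less_imp_le)
  let ?m = "real (Suc k)"
  let ?A = "p * (p - 1) ^ k / (?m * Gamma (?m / 2))"
  have "intrinsic_volume j (weighted_lp_ball p a) = steiner_coeff p c k / unit_ball_vol ?m"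
    unfolding ball using assms(4)
    by (subst intrinsic_volume_eqI[OF steiner_formula_sublevel[of p c, OF assms(1) c]]) (simp_all add: k_def)
  also have "\<dots> = ?C * ?S"
  proof -
    have G: "Gamma (1 + real j / p) > 0" using assms(1) by (intro Gamma_real_pos add_pos_nonneg) auto
    have Gm: "Gamma (?m / 2) > 0" by (rule Gamma_real_pos) simp
    have "steiner_coeff p c k * Gamma (1 + real j / p) = ?A * ?S"
      using weighted_intrinsic_coeff[of p "\<lambda>r. a $ r" k, OF assms(1) assms(3) k(1)] unfolding k(2) c_def[symmetric]
      by (simp only: k_def[symmetric] k(3)[symmetric])
    then have "steiner_coeff p c k = ?A * ?S / Gamma (1 + real j / p)"
      using G by (simp only: eq_divide_eq) simp
    \<comment> \<open>Rewrites the Gamma value in the volume of the unit ball, so that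
      \<open>?m * Gamma (?m / 2)\<close> cancels against \<open>?A\<close> and only the factor 2 in
      the denominator is left.\<close>
    moreover have "Gamma (?m / 2 + 1) = ?m / 2 * Gamma (?m / 2)"
      by (rule Gamma_plus1) (auto elim!: nonpos_Ints_cases)
    ultimately have "steiner_coeff p c k / unit_ball_vol ?m =
        (?A * ?S / Gamma (1 + real j / p)) / (pi powr (?m / 2) / (?m / 2 * Gamma (?m / 2)))"
      by (simp only: unit_ball_vol_def)
    also have "\<dots> = p * (p - 1) ^ k / (2 * pi powr (?m / 2) * Gamma (1 + real j / p)) * ?S"
    proof -
      have "(P / (M * g) * T / h) / (w / (M / 2 * g)) = P / (2 * w * h) * T"
        if "M \<noteq> 0" "g \<noteq> 0" "h \<noteq> 0" "w \<noteq> 0" for P M g T h w :: real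
        using that by (simp add: field_simps)
      then show ?thesis
        using less_imp_neq[OF Gm, symmetric] less_imp_neq[OF G, symmetric] by (simp del: of_nat_Suc)
    qed
    finally show ?thesis by (simp only: k_def[symmetric] k(3)[symmetric])
  qed
  finally show ?thesis .
qed

end
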